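(* For every integer $m\geq 1$ and every integer $\ell$ with $1\le \ell\le m+1$, the subgraph of the $(2m+1)$-dimensional hypercube $Q_{2m+1}$ induced by the middle $2\ell$ levels, i.e., by all bitstrings of length $2m+1$ with at least $m+1-\ell$ and at most $m+\ell$ entries equal to $1$, has a Hamilton cycle.
   Context: The $n$-dimensional hypercube $Q_n$ is the graph whose vertices are all $\{0,1\}$-strings of length $n$, two strings being adjacent if and only if they differ in exactly one position. Level $k$ of $Q_n$ ($0\le k\le n$) is the set of all bitstrings of length $n$ with exactly $k$ entries equal to $1$. *)

theory Defs
  imports Main
begin

definition hypercube_vertices :: "nat \<Rightarrow> bool list set" where
  "hypercube_vertices n = {x. length x = n}"

definition weight :: "bool list \<Rightarrow> nat" where
  "weight x = length (filter id x)"

definition hypercube_adj :: "bool list \<Rightarrow> bool list \<Rightarrow> bool" where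
  "hypercube_adj x y \<longleftrightarrow> length x = length y \<and>
     card {i. i < length x \<and> x ! i \<noteq> y ! i} = 1"

definition level :: "nat \<Rightarrow> nat \<Rightarrow> bool list set" where
  "level n k = {x \<in> hypercube_vertices n. weight x = k}"

definition hamilton_cycle :: "('a \<Rightarrow> 'a \<Rightarrow> bool) \<Rightarrow> 'a set \<Rightarrow> 'a list \<Rightarrow> bool" where
  "hamilton_cycle adj V cs \<longleftrightarrow>
     length cs \<ge> 3 \<and> distinct cs \<and> set cs = V \<and>
     (\<forall>i < length cs - 1. adj (cs ! i) (cs ! Suc i)) \<and>
     adj (last cs) (hd cs)"

end

(*
A bitstring is parsed as w_0 0 w_1 0 ... 0 w_z 1 w_{z+1} 1 ... 1 w_k with Dyck words w_i (1 opens,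
0 closes). Turning the unmatched 1s into 0s from left to right runs down the chains of the
Greene-Kleitman symmetric chain decomposition, and every other edge of the chains, restricted to the
middle 2l levels, is a perfect matching. In the outer part of these levels, the shell, there is a
second perfect matching made of local moves, a variant of the second lexical matching. The remaining
vertices are exactly the words a 0 b 0 x 1 c 1 d with a, b, c, d Dyck and x in the middle 2(l-2)
levels of a smaller cube, and these blocks are covered by Hamilton cycles by induction.

The cycles of this 2-factor are glued by exchanging edges along 4-cycles (l >= 2), or along 6-cycles
if l = 1. That enough exchanges are available is shown through an invariant: a function that is
constant along both matchings and across the exchanges depends on the length only. For l = 1 it is
a function of plane trees up to rotation and pulling of leaves; for l >= 2 the paths of the 2-factor
through the levels above the middle reduce it to a function of two Dyck words (w_0, w_1).
*)

theory Submission
  imports Defs "HOL-Combinatorics.Cycles"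
begin

section \<open>Bitstrings as sequences of Dyck words\<close>

text \<open>Cut to the window, a chain meets the shell in its two highest and two lowest vertices. A
  vertex deeper in the chain has two unmatched 0s and two unmatched 1s that can be split off on the
  outside, which is why a block loses two levels at each end. Blocks of all smaller odd dimensions
  occur, down to 1. The induction is therefore on \<open>l\<close> for all \<open>m\<close> at once,
  0 included, and a doubled edge counts as a cycle. The Hamilton cycle of a block is known only to
  exist, whereas an exchange that attaches the block needs a definite edge of it. So the induction
  also carries along the edges between v 0 and v 1 with v Dyck. The cycles of the 2-factor are never
  computed. If S is a union of cycles closed under the exchanges, then (\<open>len c\<close>,
  \<open>c \<in> S\<close>) is the invariant, and its dependence on the length alone is
  connectedness. For \<open>l \<ge> 2\<close> the paths are too irregular to be followed word by
  word: what is kept is the size of the one word that changes, and that the new word does not depend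
  on the words further right.\<close>

datatype dyck = Eps | Nd dyck dyck

fun dword :: "dyck \<Rightarrow> bool list" where
  "dword Eps = []"
| "dword (Nd a b) = True # dword a @ False # dword b"

fun dsnoc :: "dyck \<Rightarrow> dyck \<Rightarrow> dyck" where
  "dsnoc Eps v = Nd v Eps"
| "dsnoc (Nd a b) v = Nd a (dsnoc b v)"

fun dapp :: "dyck \<Rightarrow> dyck \<Rightarrow> dyck" where
  "dapp Eps v = v"
| "dapp (Nd a b) v = Nd a (dapp b v)"

fun dmir :: "dyck \<Rightarrow> dyck" where
  "dmir Eps = Eps"
| "dmir (Nd a b) = dsnoc (dmir b) (dmir a)"

lemma dword_dsnoc [simp]: "dword (dsnoc u v) = dword u @ True # dword v @ [False]"
  by (induction u) auto

lemma dmir_dsnoc [simp]: "dmir (dsnoc u v) = Nd (dmir v) (dmir u)"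
  by (induction u) auto

lemma dmir_dmir [simp]: "dmir (dmir w) = w"
  by (induction w) auto

lemma size_dsnoc [simp]: "size (dsnoc u v) = Suc (size u + size v)"
  by (induction u) auto

lemma size_dapp [simp]: "size (dapp u v) = size u + size v"
  by (induction u) auto

lemma size_dmir [simp]: "size (dmir w) = size w"
  by (induction w) auto

lemma size_dyck_0 [simp]: "size (w :: dyck) = 0 \<longleftrightarrow> w = Eps"
  by (cases w) auto

lemma dsnoc_neq_Eps [simp]: "dsnoc u v \<noteq> Eps" "Eps \<noteq> dsnoc u v"
  by (cases u; simp)+

lemma dmir_eq_iff [simp]: "dmir u = dmir v \<longleftrightarrow> u = v"
  by (metis dmir_dmir)

lemma dsnoc_eq_iff [simp]: "dsnoc u v = dsnoc u' v' \<longleftrightarrow> u = u' \<and> v = v'"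
  by (metis dmir_eq_iff dmir_dsnoc dyck.inject)

lemma dyck_dsnoc_cases: obtains "w = Eps" | u v where "w = dsnoc u v"
  by (metis dmir.simps dmir_dmir dyck.exhaust)

lemma dapp_Eps [simp]: "dapp u Eps = u"
  by (induction u) auto

lemma dapp_dsnoc: "dapp (dsnoc u v) b = dapp u (Nd v b)"
  by (induction u) auto

lemma length_dword [simp]: "length (dword w) = 2 * size w"
  by (induction w) auto

lemma weight_append [simp]: "weight (xs @ ys) = weight xs + weight ys"
  and weight_Cons [simp]: "weight (x # xs) = of_bool x + weight xs"
  and weight_Nil [simp]: "weight [] = 0"
  by (auto simp: weight_def)

lemma weight_dword [simp]: "weight (dword w) = size w"
  by (induction w) auto

definition rc :: "bool list \<Rightarrow> bool list" where
  "rc xs = map Not (rev xs)"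

lemma rc_simps [simp]: "rc [] = []" "rc (x # xs) = rc xs @ [\<not> x]" "rc (xs @ ys) = rc ys @ rc xs"
  by (auto simp: rc_def)

lemma dword_dmir [simp]: "dword (dmir w) = rc (dword w)"
  by (induction w) auto

text \<open>The triple \<open>([w\<^sub>z\<^sub>-\<^sub>1, \<dots>, w\<^sub>0], w\<^sub>z, [w\<^sub>z\<^sub>+\<^sub>1, \<dots>, w\<^sub>k])\<close> encodes the bitstring
  \<open>w\<^sub>0 0 w\<^sub>1 0 \<dots> 0 w\<^sub>z 1 w\<^sub>z\<^sub>+\<^sub>1 1 \<dots> 1 w\<^sub>k\<close>; both lists start next to the border between the
  unmatched 0s and the unmatched 1s.\<close>

type_synonym conf = "dyck list \<times> dyck \<times> dyck list"

fun word0 :: "dyck list \<Rightarrow> bool list" where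
  "word0 [] = []"
| "word0 (a # as) = word0 as @ dword a @ [False]"

fun word1 :: "dyck list \<Rightarrow> bool list" where
  "word1 [] = []"
| "word1 (b # bs) = True # dword b @ word1 bs"

fun word :: "conf \<Rightarrow> bool list" where
  "word (as, w, bs) = word0 as @ dword w @ word1 bs"

definition size_ds :: "dyck list \<Rightarrow> nat" where "size_ds as = sum_list (map size as)"

lemma size_ds_simps [simp]: "size_ds [] = 0" "size_ds (a # as) = size a + size_ds as"
  "size_ds (as @ bs) = size_ds as + size_ds bs"
  by (auto simp: size_ds_def)

lemma word0_append: "word0 (xs @ ys) = word0 ys @ word0 xs"
  by (induction xs) auto

lemma word1_append: "word1 (xs @ ys) = word1 xs @ word1 ys"
  by (induction xs) auto

fun len :: "conf \<Rightarrow> nat" where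
  "len (as, w, bs) = 2 * (size_ds as + size w + size_ds bs) + length as + length bs"

lemma length_word0: "length (word0 as) = 2 * size_ds as + length as"
  by (induction as) auto

lemma length_word1: "length (word1 as) = 2 * size_ds as + length as"
  by (induction as) auto

lemma length_word [simp]: "length (word c) = len c"
  by (cases c) (auto simp: length_word0 length_word1)

lemma weight_word0: "weight (word0 as) = size_ds as"
  by (induction as) auto

lemma weight_word1: "weight (word1 as) = size_ds as + length as"
  by (induction as) auto

lemma weight_word: "weight (word (as, w, bs)) = size_ds as + size w + size_ds bs + length bs"
  by (auto simp: weight_word0 weight_word1)

fun mir :: "conf \<Rightarrow> conf" where
  "mir (as, w, bs) = (map dmir bs, dmir w, map dmir as)"

lemma mir_mir [simp]: "mir (mir c) = c"
  by (cases c) (auto simp: o_def)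

lemma size_ds_dmir [simp]: "size_ds (map dmir as) = size_ds as"
  by (induction as) auto

lemma len_mir [simp]: "len (mir c) = len c"
  by (cases c) auto

lemma word0_dmir: "word0 (map dmir as) = rc (word1 as)"
  by (induction as) auto

lemma word1_dmir: "word1 (map dmir as) = rc (word0 as)"
  by (induction as) auto

lemma word_mir [simp]: "word (mir c) = rc (word c)"
  by (cases c) (auto simp: word0_dmir word1_dmir)

text \<open>A parser for \<^const>\<open>word\<close>; the innermost open bracket comes first in the third component.\<close>

fun step :: "conf \<Rightarrow> bool \<Rightarrow> conf" where
  "step (as, w, bs) True = (as, w, Eps # bs)"
| "step (as, w, []) False = (w # as, Eps, [])"
| "step (as, w, [b]) False = (as, dsnoc w b, [])"
| "step (as, w, b # b' # bs) False = (as, w, dsnoc b' b # bs)"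

fun unrev :: "conf \<Rightarrow> conf" where
  "unrev (as, w, bs) = (as, w, rev bs)"

lemma unrev_unrev [simp]: "unrev (unrev c) = c"
  by (cases c) auto

text \<open>The effect of reading a complete Dyck word: it joins the word inside the innermost open
  bracket, or the middle word if no bracket is open.\<close>

fun extend :: "conf \<Rightarrow> dyck \<Rightarrow> conf" where
  "extend (as, w, []) d = (as, dapp w d, [])"
| "extend (as, w, b # bs) d = (as, w, dapp b d # bs)"

lemma dapp_assoc: "dapp (dapp u v) w = dapp u (dapp v w)"
  by (induction u) auto

lemma dsnoc_conv_dapp: "dsnoc u v = dapp u (Nd v Eps)"
  by (induction u) auto

lemma foldl_step_dword: "foldl step c (dword d) = extend c d"
proof (induction d arbitrary: c)
  case Eps
  show ?case by (cases "(c, Eps)" rule: extend.cases) auto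
next
  case (Nd a b)
  show ?case
  proof (cases "(c, b)" rule: extend.cases)
    case (1 as w d)
    then show ?thesis using Nd.IH by (auto simp: dsnoc_conv_dapp dapp_assoc)
  next
    case (2 as w b' bs d)
    then show ?thesis using Nd.IH by (auto simp: dsnoc_conv_dapp dapp_assoc)
  qed
qed

lemma foldl_step_word0: "foldl step ([], Eps, []) (word0 as) = (as, Eps, [])"
  by (induction as) (auto simp: foldl_step_dword)

lemma foldl_step_word1: "foldl step (as, w, bs) (word1 cs) = (as, w, rev cs @ bs)"
  by (induction cs arbitrary: bs) (auto simp: foldl_step_dword)

text \<open>The parser inverts \<open>word\<close> up to the order of the third list. Together with
  \<open>word_parse\<close> this makes \<open>word\<close> a bijection from triples to bitstrings,
  so the proof can stay with triples until its end.\<close>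

lemma parse_word: "foldl step ([], Eps, []) (word c) = unrev c"
  by (cases c) (auto simp: foldl_step_word0 foldl_step_dword foldl_step_word1)

lemma word_step: "word (unrev (step c x)) = word (unrev c) @ [x]"
  by (cases "(c, x)" rule: step.cases) (auto simp: word1_append)

lemma word_parse: "word (unrev (foldl step ([], Eps, []) xs)) = xs"
  by (induction xs rule: rev_induct) (auto simp: word_step)

lemma inj_word: "inj word"
  by (metis injI parse_word unrev_unrev)

lemma surj_word: "surj word"
  by (rule surjI) (rule word_parse)

section \<open>Adjacency in the hypercube as a single flipped bit\<close>

definition flip :: "bool list \<Rightarrow> bool list \<Rightarrow> bool" where
  "flip xs ys \<longleftrightarrow> (\<exists>us vs b. xs = us @ b # vs \<and> ys = us @ (\<not> b) # vs)"

lemma flipI: "xs = us @ b # vs \<Longrightarrow> ys = us @ (\<not> b) # vs \<Longrightarrow> flip xs ys"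
  by (auto simp: flip_def)

lemma flip_sym: "flip xs ys \<Longrightarrow> flip ys xs"
  unfolding flip_def by fastforce

lemma flip_rc: "flip xs ys \<Longrightarrow> flip (rc xs) (rc ys)"
  unfolding flip_def
  by (elim exE conjE, rule_tac x = "rc vs" in exI, rule_tac x = "rc us" in exI, rule_tac x = "\<not> b" in exI) simp

lemma flip_append: "flip xs ys \<Longrightarrow> flip (us @ xs @ vs) (us @ ys @ vs)"
  unfolding flip_def by (metis append.assoc append_Cons)

lemma flip_imp_adj:
  assumes "flip xs ys"
  shows "hypercube_adj xs ys"
proof -
  obtain us vs b where "xs = us @ b # vs" "ys = us @ (\<not> b) # vs"
    using assms by (auto simp: flip_def)
  moreover from this have "{i. i < length xs \<and> xs ! i \<noteq> ys ! i} = {length us}"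
    by (auto simp: nth_append nth_Cons' split: if_splits)
  ultimately show ?thesis by (simp add: hypercube_adj_def)
qed

definition cadj :: "conf \<Rightarrow> conf \<Rightarrow> bool" where
  "cadj c d \<longleftrightarrow> flip (word c) (word d)"

lemma cadj_sym: "cadj c d \<Longrightarrow> cadj d c"
  by (simp add: cadj_def flip_sym)

lemma cadj_mir: "cadj c d \<Longrightarrow> cadj (mir c) (mir d)"
  by (simp add: cadj_def flip_rc)

lemma cadj_mir_iff [simp]: "cadj (mir c) (mir d) \<longleftrightarrow> cadj c d"
  by (metis cadj_mir mir_mir)

section \<open>Cycles and their gluing\<close>

fun pedges :: "'a list \<Rightarrow> 'a set set" where
  "pedges (x # y # xs) = insert {x, y} (pedges (y # xs))"
| "pedges _ = {}"

definition edges :: "'a list \<Rightarrow> 'a set set" where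
  "edges c = insert {last c, hd c} (pedges c)"

lemma pedges_append:
  "xs \<noteq> [] \<Longrightarrow> ys \<noteq> [] \<Longrightarrow>
    pedges (xs @ ys) = insert {last xs, hd ys} (pedges xs \<union> pedges ys)"
proof (induction xs rule: pedges.induct)
  case ("2_2" v)
  then show ?case by (cases ys) auto
qed auto

lemma pedges_rev [simp]: "pedges (rev xs) = pedges xs"
proof (induction xs rule: pedges.induct)
  case (1 x y xs)
  then show ?case
    using pedges_append[of "rev (y # xs)" "[x]"] by (simp add: insert_commute)
qed auto

lemma edges_rev [simp]: "c \<noteq> [] \<Longrightarrow> edges (rev c) = edges c"
  by (simp add: edges_def last_rev hd_rev insert_commute)

lemma edges_append_swap: "edges (xs @ ys) = edges (ys @ xs)"
  by (cases "xs = [] \<or> ys = []") (auto simp: edges_def pedges_append)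

lemma pedges_split:
  "e \<in> pedges c \<Longrightarrow> \<exists>xs u v ys. c = xs @ u # v # ys \<and> e = {u, v}"
proof (induction c rule: pedges.induct)
  case (1 x y xs)
  show ?case
  proof (cases "e = {x, y}")
    case True
    then show ?thesis by (metis append_Nil)
  next
    case False
    with 1 show ?thesis by (metis append_Cons insert_iff pedges.simps(1))
  qed
qed auto

lemma pedges_subset: "e \<in> pedges c \<Longrightarrow> e \<subseteq> set c"
  by (drule pedges_split) auto

lemma edges_subset: "e \<in> edges c \<Longrightarrow> c \<noteq> [] \<Longrightarrow> e \<subseteq> set c"
  unfolding edges_def using pedges_subset by fastforce

text \<open>Closed walks of length two, that is, doubled edges, are admitted as cycles here.\<close>

definition cyc :: "('a \<Rightarrow> 'a \<Rightarrow> bool) \<Rightarrow> 'a list \<Rightarrow> bool" where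
  "cyc R c \<longleftrightarrow> distinct c \<and> 2 \<le> length c \<and> (\<forall>x y. {x, y} \<in> edges c \<longrightarrow> R x y)"

lemma cyc_nonempty: "cyc R c \<Longrightarrow> c \<noteq> []"
  by (auto simp: cyc_def)

text \<open>Rotating or reversing the list keeps the edge set, so a cycle can be cut open at any
  edge, in either direction.\<close>

lemma edges_open:
  assumes "{u, v} \<in> edges c" "distinct c" "c \<noteq> []"
  shows "\<exists>c'. set c' = set c \<and> distinct c' \<and> length c' = length c \<and> edges c' = edges c
    \<and> hd c' = u \<and> last c' = v"
proof -
  have main: "\<exists>c'. set c' = set c \<and> distinct c' \<and> length c' = length c \<and> edges c' = edges c
    \<and> {hd c', last c'} = {u, v}"
  proof (cases "{u, v} = {last c, hd c}")
    case True
    with assms show ?thesis by auto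
  next
    case False
    then obtain xs a b ys where *: "c = xs @ a # b # ys" "{u, v} = {a, b}"
      using assms pedges_split[of "{u, v}" c] by (auto simp: edges_def)
    let ?c = "(b # ys) @ (xs @ [a])"
    have "edges ?c = edges c"
      using edges_append_swap[of "xs @ [a]" "b # ys"] * by simp
    moreover have "set ?c = set c" "distinct ?c" "length ?c = length c"
      using * assms by auto
    moreover have "{hd ?c, last ?c} = {u, v}"
      using * by auto
    ultimately show ?thesis by blast
  qed
  then obtain c' where c': "set c' = set c" "distinct c'" "length c' = length c"
    "edges c' = edges c" "{hd c', last c'} = {u, v}" by blast
  then have ne: "c' \<noteq> []" using assms by auto
  show ?thesis
  proof (cases "hd c' = u \<and> last c' = v")
    case True
    with c' show ?thesis by blast
  next
    case False
    then have "hd (rev c') = u \<and> last (rev c') = v"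
      using c'(5) ne by (auto simp: doubleton_eq_iff hd_rev last_rev)
    moreover have "edges (rev c') = edges c" using c' ne by simp
    ultimately show ?thesis using c' by (metis distinct_rev length_rev set_rev)
  qed
qed

text \<open>An exchange of edges that joins the cycle through \<open>end1\<close> to the cycle through \<open>end2\<close>. It
  needs the edges \<open>used\<close> and destroys only the edges \<open>removed\<close>, so exchanges can be made one after the
  other as long as none of them destroys an edge that another one needs.\<close>

record 'a toggle =
  end1 :: 'a
  end2 :: 'a
  used :: "'a set set"
  removed :: "'a set set"

text \<open>Each of the two cycles claims the used edges that it meets; the record need not say
  which edge lies on which cycle.\<close>

definition merges :: "('a \<Rightarrow> 'a \<Rightarrow> bool) \<Rightarrow> 'a toggle \<Rightarrow> bool" where
  "merges R t \<longleftrightarrow> (\<forall>c1 c2. cyc R c1 \<and> cyc R c2 \<and> set c1 \<inter> set c2 = {} \<and> end1 t \<in> set c1 \<and> end2 t \<in> set c2 \<and>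
     (\<forall>e\<in>used t. (e \<inter> set c1 \<noteq> {} \<longrightarrow> e \<in> edges c1) \<and> (e \<inter> set c2 \<noteq> {} \<longrightarrow> e \<in> edges c2)) \<longrightarrow>
     (\<exists>c. cyc R c \<and> set c = set c1 \<union> set c2 \<and> (edges c1 \<union> edges c2) - removed t \<subseteq> edges c))"

lemma cyc_open:
  assumes "cyc R c" "{u, v} \<in> edges c"
  obtains c' where "set c' = set c" "distinct c'" "length c' = length c" "edges c' = edges c"
    "hd c' = u" "last c' = v" "c' \<noteq> []"
proof -
  obtain c' where c': "set c' = set c" "distinct c'" "length c' = length c" "edges c' = edges c"
    "hd c' = u" "last c' = v"
    using edges_open[OF assms(2)] assms(1) cyc_nonempty[OF assms(1)] unfolding cyc_def by blast
  moreover have "c' \<noteq> []" using c'(1) cyc_nonempty[OF assms(1)] by auto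
  ultimately show ?thesis using that by blast
qed

text \<open>By induction on the number of cycles. An exchange with ends on two different cycles is
  carried out and discarded; independence preserves the edges that the others need. If there is no
  such exchange, every single cycle is a closed set and hence all of \<open>V\<close>.\<close>

lemma glue_cycles:
  assumes "finite \<C>" "\<C> \<noteq> {}"
    and "\<And>c. c \<in> \<C> \<Longrightarrow> cyc R c"
    and "\<And>c d. c \<in> \<C> \<Longrightarrow> d \<in> \<C> \<Longrightarrow> c \<noteq> d \<Longrightarrow> set c \<inter> set d = {}"
    and "(\<Union>c\<in>\<C>. set c) = V"
    and "\<And>t. t \<in> \<T> \<Longrightarrow> merges R t"
    and "\<And>t. t \<in> \<T> \<Longrightarrow> end1 t \<in> V \<and> end2 t \<in> V"
    and "\<And>t. t \<in> \<T> \<Longrightarrow> used t \<subseteq> (\<Union>c\<in>\<C>. edges c)"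
    and "\<And>t t'. t \<in> \<T> \<Longrightarrow> t' \<in> \<T> \<Longrightarrow> t \<noteq> t' \<Longrightarrow> used t \<inter> removed t' = {}"
    and "\<And>S. S \<subseteq> V \<Longrightarrow> S \<noteq> {} \<Longrightarrow> (\<And>c. c \<in> \<C> \<Longrightarrow> set c \<subseteq> S \<or> set c \<inter> S = {}) \<Longrightarrow>
           (\<And>t. t \<in> \<T> \<Longrightarrow> end1 t \<in> S \<longleftrightarrow> end2 t \<in> S) \<Longrightarrow> S = V"
  shows "\<exists>c. cyc R c \<and> set c = V \<and> (\<Union>c\<in>\<C>. edges c) - (\<Union>t\<in>\<T>. removed t) \<subseteq> edges c"
  using assms
proof (induction "card \<C>" arbitrary: \<C> \<T> rule: less_induct)
  case less
  note fin = less.prems(1) and ne = less.prems(2) and cyc = less.prems(3) and disj = less.prems(4)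
    and cover = less.prems(5) and mrg = less.prems(6) and ends = less.prems(7)
    and used = less.prems(8) and indep = less.prems(9) and conn = less.prems(10)
  obtain c0 where c0: "c0 \<in> \<C>" using ne by blast
  show ?case
  proof (cases "\<exists>t\<in>\<T>. \<exists>c1\<in>\<C>. \<exists>c2\<in>\<C>. c1 \<noteq> c2 \<and> end1 t \<in> set c1 \<and> end2 t \<in> set c2")
    case False
    have "set c0 = V"
    proof (rule conn)
      show "set c0 \<subseteq> V" using c0 cover by auto
      show "set c0 \<noteq> {}" using cyc_nonempty cyc[OF c0] by auto
      show "set c \<subseteq> set c0 \<or> set c \<inter> set c0 = {}" if "c \<in> \<C>" for c
        using disj[OF that c0] by auto
      show "end1 t \<in> set c0 \<longleftrightarrow> end2 t \<in> set c0" if t: "t \<in> \<T>" for t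
      proof -
        obtain c1 c2 where "c1 \<in> \<C>" "c2 \<in> \<C>" "end1 t \<in> set c1" "end2 t \<in> set c2"
          using ends[OF t] cover by blast
        moreover from this have "c1 = c2" using False t by blast
        ultimately show ?thesis using disj[OF c0, of c1] by blast
      qed
    qed
    moreover have "\<C> = {c0}"
    proof -
      have "c = c0" if "c \<in> \<C>" for c
      proof (rule ccontr)
        assume "c \<noteq> c0"
        then have "set c \<inter> set c0 = {}" using disj[OF that c0] by blast
        moreover have "set c \<subseteq> V" "set c \<noteq> {}"
          using that cover cyc_nonempty[OF cyc[OF that]] by auto
        ultimately show False using \<open>set c0 = V\<close> Int_absorb2[of "set c" "set c0"] by simp
      qed
      then show ?thesis using c0 by blast
    qed
    ultimately show ?thesis using cyc[OF c0] by auto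
  next
    case True
    then obtain t c1 c2 where t: "t \<in> \<T>" and c12: "c1 \<in> \<C>" "c2 \<in> \<C>" "c1 \<noteq> c2"
      "end1 t \<in> set c1" "end2 t \<in> set c2" by blast
    have owner: "e \<in> edges d" if "e \<in> used t" "e \<inter> set d \<noteq> {}" "d \<in> \<C>" for e d
    proof -
      obtain d' where d': "d' \<in> \<C>" "e \<in> edges d'" using used[OF t] \<open>e \<in> used t\<close> by blast
      have "e \<subseteq> set d'" using edges_subset[OF d'(2)] cyc_nonempty[OF cyc[OF d'(1)]] by simp
      then have "d' = d" using disj[OF d'(1) that(3)] that(2) by auto
      with d' show ?thesis by simp
    qed
    have hyp: "cyc R c1 \<and> cyc R c2 \<and> set c1 \<inter> set c2 = {} \<and> end1 t \<in> set c1 \<and> end2 t \<in> set c2 \<and>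
      (\<forall>e\<in>used t. (e \<inter> set c1 \<noteq> {} \<longrightarrow> e \<in> edges c1) \<and> (e \<inter> set c2 \<noteq> {} \<longrightarrow> e \<in> edges c2))"
      using cyc[OF c12(1)] cyc[OF c12(2)] disj[OF c12(1-3)] c12 owner by simp
    then obtain c where c: "cyc R c" "set c = set c1 \<union> set c2"
      "(edges c1 \<union> edges c2) - removed t \<subseteq> edges c"
      using mrg[OF t, unfolded merges_def, rule_format, OF hyp] by (elim exE conjE)
    let ?D = "\<C> - {c1, c2}"
    let ?\<C> = "insert c ?D"
    have cD: "c \<notin> ?D"
    proof
      assume "c \<in> ?D"
      then have "set c \<inter> set c1 = {}" using disj[of c c1] c12 by simp
      then show False using c(2) c12(4) by auto
    qed
    have sub: "(\<Union>c\<in>\<C>. edges c) - removed t \<subseteq> (\<Union>c\<in>?\<C>. edges c)"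
      using c(3) by blast
    have disjc: "set c \<inter> set d = {}" if "d \<in> ?D" for d
      using disj[of c1 d] disj[of c2 d] c12 c(2) that by auto
    have "card ?D + 2 = card \<C>"
    proof -
      have "card {c1, c2} = 2" using c12 by simp
      moreover have "card {c1, c2} \<le> card \<C>" using fin c12 by (intro card_mono) auto
      ultimately show ?thesis using fin c12 by (subst card_Diff_subset) auto
    qed
    then have card: "card ?\<C> < card \<C>" using fin cD by simp
    have "\<exists>c'. cyc R c' \<and> set c' = V \<and> (\<Union>c\<in>?\<C>. edges c) - (\<Union>t\<in>\<T> - {t}. removed t) \<subseteq> edges c'"
    proof (rule less.hyps[OF card])
      show "finite ?\<C>" "?\<C> \<noteq> {}" using fin by auto
      show "cyc R d" if "d \<in> ?\<C>" for d using that cyc c(1) by blast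
      show "set d \<inter> set d' = {}" if "d \<in> ?\<C>" "d' \<in> ?\<C>" "d \<noteq> d'" for d d'
        using that disjc disj[of d d'] by blast
      show "(\<Union>c\<in>?\<C>. set c) = V" using cover c(2) c12 by auto
      show "merges R t'" "end1 t' \<in> V \<and> end2 t' \<in> V" if "t' \<in> \<T> - {t}" for t'
        using that mrg ends by auto
      show "used t' \<subseteq> (\<Union>c\<in>?\<C>. edges c)" if "t' \<in> \<T> - {t}" for t'
      proof -
        have "used t' \<subseteq> (\<Union>c\<in>\<C>. edges c)" using used that by blast
        moreover have "used t' \<inter> removed t = {}" using indep that t by blast
        ultimately show ?thesis using sub by blast
      qed
      show "used t' \<inter> removed t'' = {}" if "t' \<in> \<T> - {t}" "t'' \<in> \<T> - {t}" "t' \<noteq> t''" for t' t''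
        using that indep by blast
      show "S = V" if S: "S \<subseteq> V" "S \<noteq> {}" "\<And>d. d \<in> ?\<C> \<Longrightarrow> set d \<subseteq> S \<or> set d \<inter> S = {}"
        "\<And>t'. t' \<in> \<T> - {t} \<Longrightarrow> end1 t' \<in> S \<longleftrightarrow> end2 t' \<in> S" for S
      proof (rule conn[OF S(1,2)])
        have cS: "set c \<subseteq> S \<or> set c \<inter> S = {}" using S(3) by blast
        show "set d \<subseteq> S \<or> set d \<inter> S = {}" if "d \<in> \<C>" for d
          using cS c(2) S(3)[of d] that by blast
        \<comment> \<open>The discarded \<open>t\<close> has both ends on the new cycle
          \<open>c\<close>, so a set closed for the new data is closed for \<open>t\<close> as
          well.\<close>
        show "end1 t' \<in> S \<longleftrightarrow> end2 t' \<in> S" if "t' \<in> \<T>" for t'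
          using cS c(2) c12 S(4)[of t'] that by blast
      qed
    qed
    then obtain c' where "cyc R c' \<and> set c' = V \<and>
      (\<Union>c\<in>?\<C>. edges c) - (\<Union>t\<in>\<T> - {t}. removed t) \<subseteq> edges c'" by (rule exE)
    note c' = this[THEN conjunct1] this[THEN conjunct2, THEN conjunct1]
      this[THEN conjunct2, THEN conjunct2]
    have "e \<in> edges c'" if "e \<in> (\<Union>c\<in>\<C>. edges c) - (\<Union>t\<in>\<T>. removed t)" for e
    proof -
      have "e \<in> (\<Union>c\<in>\<C>. edges c)" "e \<notin> removed t" using that t by auto
      then have "e \<in> (\<Union>c\<in>?\<C>. edges c)" using subsetD[OF sub] by simp
      moreover have "e \<notin> (\<Union>t\<in>\<T> - {t}. removed t)" using that by simp
      ultimately show ?thesis using subsetD[OF c'(3)] by simp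
    qed
    then show ?thesis using c' by (intro exI[of _ c']) (simp add: subset_iff)
  qed
qed

text \<open>Cut open at the removed edges, the cycles are paths from \<open>x\<close> to
  \<open>y\<close> and from \<open>y'\<close> to \<open>x'\<close>; concatenated, they close up
  through the other two sides of the square.\<close>

lemma merges_square:
  assumes sym: "\<And>x y. R x y \<Longrightarrow> R y x"
    and "R x x'" "R y y'"
    and used: "{x, y} \<in> used t" "{x', y'} \<in> used t"
    and removed: "{x, y} \<in> removed t" "{x', y'} \<in> removed t"
    and ends: "end1 t = x" "end2 t = x'"
  shows "merges R t"
  unfolding merges_def
proof (intro allI impI, elim conjE)
  fix c1 c2
  assume c: "cyc R c1" "cyc R c2" "set c1 \<inter> set c2 = {}" "end1 t \<in> set c1" "end2 t \<in> set c2"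
    and "\<forall>e\<in>used t. (e \<inter> set c1 \<noteq> {} \<longrightarrow> e \<in> edges c1) \<and> (e \<inter> set c2 \<noteq> {} \<longrightarrow> e \<in> edges c2)"
  then have e: "{x, y} \<in> edges c1" "{y', x'} \<in> edges c2"
    using used ends by (auto simp: insert_commute)
  obtain d1 where d1: "set d1 = set c1" "distinct d1" "length d1 = length c1" "edges d1 = edges c1"
    "hd d1 = x" "last d1 = y" "d1 \<noteq> []"
    by (rule cyc_open[OF c(1) e(1)])
  obtain d2 where d2: "set d2 = set c2" "distinct d2" "length d2 = length c2" "edges d2 = edges c2"
    "hd d2 = y'" "last d2 = x'" "d2 \<noteq> []"
    by (rule cyc_open[OF c(2) e(2)])
  have ed: "edges (d1 @ d2) = {{x', x}, {y, y'}} \<union> pedges d1 \<union> pedges d2"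
    using d1 d2 by (auto simp: edges_def pedges_append)
  have "pedges d1 \<subseteq> edges c1" "pedges d2 \<subseteq> edges c2"
    using d1 d2 by (auto simp: edges_def)
  then have "\<forall>u v. {u, v} \<in> edges (d1 @ d2) \<longrightarrow> R u v"
    using c(1,2) assms(1,2,3) unfolding ed cyc_def by (auto simp: doubleton_eq_iff)
  moreover have "distinct (d1 @ d2)" "2 \<le> length (d1 @ d2)" "set (d1 @ d2) = set c1 \<union> set c2"
    using d1 d2 c by (auto simp: cyc_def)
  moreover have "edges c1 \<union> edges c2 - removed t \<subseteq> edges (d1 @ d2)"
  proof -
    have "edges c1 = insert {x, y} (pedges d1)" "edges c2 = insert {x', y'} (pedges d2)"
      using d1 d2 by (auto simp: edges_def insert_commute)
    then show ?thesis using removed ed by auto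
  qed
  ultimately show "\<exists>c. cyc R c \<and> set c = set c1 \<union> set c2 \<and> edges c1 \<union> edges c2 - removed t \<subseteq> edges c"
    unfolding cyc_def by (intro exI[of _ "d1 @ d2"]) simp
qed

text \<open>Avoiding \<open>last d\<close>, the walk cannot use the closing edge of the cycle, and
  being distinct it cannot turn back, so it has to follow the list.\<close>

lemma walk_prefix:
  assumes "distinct d" "distinct ws" "ws \<noteq> []" "hd ws = hd d" "d \<noteq> []" "pedges ws \<subseteq> edges d"
    and "last d \<notin> set ws"
  shows "\<exists>r. d = ws @ r"
  using assms(2-)
proof (induction ws rule: rev_induct)
  case (snoc w ws)
  show ?case
  proof (cases "ws = []")
    case True
    then show ?thesis using snoc.prems by (cases d) auto
  next
    case False
    then have "pedges (ws @ [w]) = insert {last ws, w} (pedges ws)"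
      by (simp add: pedges_append)
    then have sub: "pedges ws \<subseteq> edges d" "{last ws, w} \<in> edges d"
      using snoc.prems by auto
    then obtain r where r: "d = ws @ r"
      using snoc False by auto
    then have rne: "r \<noteq> []" using snoc.prems False by auto
    obtain xs a where ws: "ws = xs @ [a]" using False by (metis rev_exhaust)
    have ed: "edges d = {{last r, hd ws}, {a, hd r}} \<union> pedges ws \<union> pedges r"
    proof -
      have "last d = last r" "hd d = hd ws" "last ws = a" using r rne False ws by (auto simp: hd_append)
      then show ?thesis using pedges_append[OF False rne] r by (auto simp: edges_def)
    qed
    have a: "a \<noteq> last r" "a \<noteq> w" "w \<notin> set ws" "w \<noteq> last r" "a \<notin> set r"
      using snoc.prems r rne ws assms(1) by auto
    consider "{a, w} = {last r, hd ws}" | "{a, w} = {a, hd r}" | "{a, w} \<in> pedges ws" | "{a, w} \<in> pedges r"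
      using sub(2) ed ws by auto
    then have "w = hd r"
    proof cases
      case 1
      then show ?thesis using a by (auto simp: doubleton_eq_iff)
    next
      case 2
      then show ?thesis using a by (auto simp: doubleton_eq_iff)
    next
      case 3
      then show ?thesis using a pedges_subset by fastforce
    next
      case 4
      then show ?thesis using a pedges_subset by fastforce
    qed
    then have "d = (ws @ [w]) @ tl r" using r rne by simp
    then show ?thesis by blast
  qed
qed simp

text \<open>The 6-cycle is \<open>x\<close>, \<open>hd P\<close>, \<open>z\<close>,
  \<open>last P\<close>, \<open>y\<close>, \<open>y'\<close>, and alternate sides are exchanged. Two
  of the removed sides lie on the same cycle, so the outcome depends on their order along it; the
  walk \<open>x # P @ [z]\<close> fixes that order.\<close>

lemma merges_hexagon:
  assumes sym: "\<And>x y. R x y \<Longrightarrow> R y x"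
    and R: "R z (hd P)" "R (last P) y" "R x y'"
    and walk: "distinct (x # P @ [z])" "P \<noteq> []"
    and used: "pedges (x # P @ [z]) \<subseteq> used t" "{y, y'} \<in> used t"
    and removed: "{x, hd P} \<in> removed t" "{last P, z} \<in> removed t" "{y, y'} \<in> removed t"
    and ends: "end1 t = x" "end2 t = y"
  shows "merges R t"
  unfolding merges_def
proof (intro allI impI, elim conjE)
  fix c1 c2
  assume c: "cyc R c1" "cyc R c2" "set c1 \<inter> set c2 = {}" "end1 t \<in> set c1" "end2 t \<in> set c2"
    and u: "\<forall>e\<in>used t. (e \<inter> set c1 \<noteq> {} \<longrightarrow> e \<in> edges c1) \<and> (e \<inter> set c2 \<noteq> {} \<longrightarrow> e \<in> edges c2)"
  have e2: "{y, y'} \<in> edges c2" using u used c ends by auto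
  have walk1: "pedges (x # P') \<subseteq> edges c1 \<and> set (x # P') \<subseteq> set c1"
    if "pedges (x # P') \<subseteq> used t" for P'
    using that
  proof (induction P' rule: rev_induct)
    case Nil
    then show ?case using c ends by simp
  next
    case (snoc w ws)
    have eq: "pedges (x # ws @ [w]) = insert {last (x # ws), w} (pedges (x # ws))"
      using pedges_append[of "x # ws" "[w]"] by simp
    then have IH: "pedges (x # ws) \<subseteq> edges c1" "set (x # ws) \<subseteq> set c1"
      using snoc by auto
    have l: "last (x # ws) \<in> set c1" using IH(2) last_in_set[of "x # ws"] by blast
    then have "{last (x # ws), w} \<in> edges c1" using eq snoc.prems u by auto
    then show ?case using edges_subset[OF _ cyc_nonempty[OF c(1)]] eq IH by fastforce
  qed
  have e1: "pedges (x # P @ [z]) \<subseteq> edges c1" using walk1[OF used(1)] by simp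
  have Pz: "pedges (x # P @ [z]) = {{x, hd P}, {last P, z}} \<union> pedges P"
    using walk(2) pedges_append[of "[x]" "P @ [z]"] pedges_append[of P "[z]"] by auto
  then have "{hd P, x} \<in> edges c1" using e1 by (auto simp: insert_commute)
  then obtain d1 where d1: "set d1 = set c1" "distinct d1" "length d1 = length c1" "edges d1 = edges c1"
    "hd d1 = hd P" "last d1 = x" "d1 \<noteq> []"
    by (rule cyc_open[OF c(1)])
  obtain d2 where d2: "set d2 = set c2" "distinct d2" "length d2 = length c2" "edges d2 = edges c2"
    "hd d2 = y" "last d2 = y'" "d2 \<noteq> []"
    by (rule cyc_open[OF c(2) e2])
  have "pedges (P @ [z]) \<subseteq> edges d1"
    using e1 Pz d1(4) walk(2) pedges_append[of P "[z]"] by auto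
  then obtain r where r: "d1 = (P @ [z]) @ r"
    using walk_prefix[of d1 "P @ [z]"] walk d1 by auto
  then have rne: "r \<noteq> []" "last r = x" using d1 walk by auto
  have ed1: "edges c1 = {{x, hd P}, {last P, z}} \<union> pedges P \<union> pedges (z # r)"
    unfolding d1(4)[symmetric]
    using r rne walk(2) pedges_append[of P "z # r"] by (auto simp: edges_def)
  have ed2: "edges c2 = insert {y, y'} (pedges d2)"
    using d2 by (auto simp: edges_def insert_commute)
  \<comment> \<open>Through \<open>P\<close>, then along the second cycle from \<open>y\<close> to
    \<open>y'\<close>, then along the rest of the first cycle from \<open>x\<close> to
    \<open>z\<close>.\<close>
  let ?c = "P @ d2 @ rev (z # r)"
  have "last (rev (z # r)) = z" "hd (rev (z # r)) = x" "rev (z # r) \<noteq> []"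
    using rne by (simp_all add: hd_rev last_rev)
  then have ed: "edges ?c = {{z, hd P}, {last P, y}, {y', x}} \<union> pedges P \<union> pedges d2 \<union> pedges (z # r)"
    using walk(2) d2 pedges_append[of P "d2 @ rev (z # r)"] pedges_append[of d2 "rev (z # r)"]
    by (auto simp: edges_def simp del: rev.simps)
  have R1: "\<forall>u v. {u, v} \<in> pedges P \<union> pedges d2 \<union> pedges (z # r) \<longrightarrow> R u v"
    using c(1,2) ed1 ed2 unfolding cyc_def by auto
  have "\<forall>u v. {u, v} \<in> edges ?c \<longrightarrow> R u v"
    unfolding ed using R1 R sym by (auto simp: doubleton_eq_iff)
  moreover have "distinct ?c" "2 \<le> length ?c" "set ?c = set c1 \<union> set c2"
    using d1 d2 c r rne by (auto simp: cyc_def)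
  moreover have "edges c1 \<union> edges c2 - removed t \<subseteq> edges ?c"
    unfolding ed1 ed2 ed using removed by auto
  ultimately show "\<exists>c. cyc R c \<and> set c = set c1 \<union> set c2 \<and> edges c1 \<union> edges c2 - removed t \<subseteq> edges c"
    unfolding cyc_def by (intro exI[of _ ?c]) simp
qed

section \<open>Cycles from the orbits of a permutation\<close>

lemma edges_support:
  assumes "permutation p"
  shows "edges (support p x) = (\<lambda>y. {y, p y}) ` set (support p x)"
proof -
  let ?k = "least_power p x"
  have k: "?k > 0" "(p ^^ ?k) x = x" using least_power_of_permutation[OF assms] by auto
  have pe: "pedges (map (\<lambda>i. (p ^^ i) x) [0..<Suc n]) = (\<lambda>i. {(p ^^ i) x, p ((p ^^ i) x)}) ` {..<n}" for n
  proof (induction n)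
    case (Suc n)
    have "map (\<lambda>i. (p ^^ i) x) [0..<Suc (Suc n)] = map (\<lambda>i. (p ^^ i) x) [0..<Suc n] @ [(p ^^ Suc n) x]"
      by simp
    then have "pedges (map (\<lambda>i. (p ^^ i) x) [0..<Suc (Suc n)]) =
      insert {(p ^^ n) x, (p ^^ Suc n) x} (pedges (map (\<lambda>i. (p ^^ i) x) [0..<Suc n]))"
      by (simp add: pedges_append del: upt.simps) (simp add: last_map)
    then show ?case unfolding Suc by (auto simp: lessThan_Suc)
  qed simp
  obtain n where n: "?k = Suc n" using k by (cases ?k) auto
  have "last (support p x) = (p ^^ n) x" using n by simp
  moreover have "hd (support p x) = x" using n by (simp add: hd_map del: upt_Suc)
  moreover have "p ((p ^^ n) x) = x" using k n by simp
  ultimately have "{last (support p x), hd (support p x)} = {(p ^^ n) x, p ((p ^^ n) x)}" by simp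
  then have "edges (support p x) = (\<lambda>i. {(p ^^ i) x, p ((p ^^ i) x)}) ` {..<Suc n}"
    unfolding edges_def using pe[of n] n by (simp only: lessThan_Suc image_insert)
  also have "\<dots> = (\<lambda>y. {y, p y}) ` set (support p x)"
    using n by (simp only: set_map set_upt atLeast0LessThan image_image)
  finally show ?thesis .
qed

text \<open>The cycles are the orbits of the permutation that alternates between the two matchings.\<close>

lemma cycles_of_two_matchings:
  assumes fin: "finite V" and sym: "\<And>x y. R x y \<Longrightarrow> R y x"
    and \<alpha>: "\<And>x. x \<in> V \<Longrightarrow> \<alpha> x \<in> V \<and> \<alpha> (\<alpha> x) = x \<and> R x (\<alpha> x) \<and> (Q (\<alpha> x) \<longleftrightarrow> \<not> Q x)"
    and \<beta>: "\<And>x. x \<in> V \<Longrightarrow> \<beta> x \<in> V \<and> \<beta> (\<beta> x) = x \<and> R x (\<beta> x) \<and> (Q (\<beta> x) \<longleftrightarrow> \<not> Q x)"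
  obtains \<C> where "finite \<C>" "\<And>c. c \<in> \<C> \<Longrightarrow> cyc R c"
    "\<And>c d. c \<in> \<C> \<Longrightarrow> d \<in> \<C> \<Longrightarrow> c \<noteq> d \<Longrightarrow> set c \<inter> set d = {}" "(\<Union>c\<in>\<C>. set c) = V"
    "\<And>x. x \<in> V \<Longrightarrow> {x, \<alpha> x} \<in> (\<Union>c\<in>\<C>. edges c)" "\<And>x. x \<in> V \<Longrightarrow> {x, \<beta> x} \<in> (\<Union>c\<in>\<C>. edges c)"
proof -
  define p where "p x = (if x \<in> V then if Q x then \<alpha> x else \<beta> x else x)" for x
  have "inj_on p V"
  proof (rule inj_onI)
    fix x y assume xy: "x \<in> V" "y \<in> V" "p x = p y"
    note V = \<alpha>[OF xy(1)] \<alpha>[OF xy(2)] \<beta>[OF xy(1)] \<beta>[OF xy(2)]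
    have Q: "Q (p x) \<longleftrightarrow> \<not> Q x" "Q (p y) \<longleftrightarrow> \<not> Q y" using V xy(1,2) by (simp_all add: p_def)
    have "\<alpha> x = \<alpha> y \<or> \<beta> x = \<beta> y"
    proof (cases "Q x")
      case True
      then have "p x = \<alpha> x" "p y = \<alpha> y" using Q xy by (simp_all add: p_def)
      then show ?thesis using xy(3) by simp
    next
      case False
      then have "p x = \<beta> x" "p y = \<beta> y" using Q xy by (simp_all add: p_def)
      then show ?thesis using xy(3) by simp
    qed
    then show "x = y" using V by metis
  qed
  moreover have "p ` V \<subseteq> V" using \<alpha> \<beta> by (auto simp: p_def)
  ultimately have "bij_betw p V V"
    using fin by (simp add: bij_betw_def endo_inj_surj)
  then have perm: "p permutes V" by (rule bij_imp_permutes) (auto simp: p_def)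
  then have pp: "permutation p" using fin permutation_permutes by blast
  \<comment> \<open>Points of one orbit give lists that differ by a rotation; one list is chosen for
    each vertex set.\<close>
  define \<C> where "\<C> = (\<lambda>A. SOME c. c \<in> support p ` V \<and> set c = A) ` (\<lambda>x. set (support p x)) ` V"
  have rep: "c \<in> support p ` V" if "c \<in> \<C>" for c
  proof -
    from that obtain x where x: "x \<in> V" "c = (SOME c. c \<in> support p ` V \<and> set c = set (support p x))"
      by (auto simp: \<C>_def)
    have "\<exists>c. c \<in> support p ` V \<and> set c = set (support p x)" using x by blast
    from someI_ex[OF this] show ?thesis using x by simp
  qed
  have cover: "\<exists>c\<in>\<C>. set c = set (support p x)" if x: "x \<in> V" for x
  proof -
    have "\<exists>c. c \<in> support p ` V \<and> set c = set (support p x)" using x by blast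
    from someI_ex[OF this] show ?thesis using x unfolding \<C>_def by blast
  qed
  have same: "c = d" if cd: "c \<in> \<C>" "d \<in> \<C>" "set c = set d" for c d
  proof -
    obtain x where x: "x \<in> V" "c = (SOME c. c \<in> support p ` V \<and> set c = set (support p x))"
      using cd by (auto simp: \<C>_def)
    obtain y where y: "y \<in> V" "d = (SOME c. c \<in> support p ` V \<and> set c = set (support p y))"
      using cd by (auto simp: \<C>_def)
    have "\<exists>c. c \<in> support p ` V \<and> set c = set (support p x)" using x by blast
    from someI_ex[OF this] have 1: "set c = set (support p x)" using x by simp
    have "\<exists>c. c \<in> support p ` V \<and> set c = set (support p y)" using y by blast
    from someI_ex[OF this] have "set d = set (support p y)" using y by simp
    then show ?thesis using x y 1 cd by simp
  qed
  have in_support: "x \<in> set (support p x)" for x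
    using support_set[OF pp, of x] by (metis funpow_0 rangeI)
  have pV: "p x \<in> V" if "x \<in> V" for x using perm that by (simp add: permutes_in_image)
  have supV: "set (support p x) \<subseteq> V" if "x \<in> V" for x
  proof -
    have "(p ^^ i) x \<in> V" for i by (induction i) (auto simp: that pV)
    then show ?thesis by auto
  qed
  have Rp: "R x (p x)" "p x \<noteq> x" if "x \<in> V" for x
    using \<alpha>[OF that] \<beta>[OF that] by (auto simp: p_def that)
  have edge: "{y, p y} \<in> (\<Union>c\<in>\<C>. edges c)" if y: "y \<in> V" for y
  proof -
    obtain c where c: "c \<in> \<C>" "set c = set (support p y)" using cover[OF y] by blast
    obtain x where x: "c = support p x" using rep[OF c(1)] by blast
    have "{y, p y} \<in> edges c" unfolding x edges_support[OF pp] using in_support[of y] c(2) x by simp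
    then show ?thesis using c by blast
  qed
  show thesis
  proof (rule that)
    show "finite \<C>" using fin by (simp add: \<C>_def)
    show "cyc R c" if c: "c \<in> \<C>" for c
    proof -
      obtain x where x: "x \<in> V" "c = support p x" using rep[OF c] by blast
      have "distinct c" unfolding x(2) by (rule cycle_of_permutation[OF pp])
      moreover have "2 \<le> length c"
        using least_power_gt_one[OF pp Rp(2)[OF x(1)]] x(2) by simp
      moreover have "R u v" if uv: "{u, v} \<in> edges c" for u v
      proof -
        obtain y where "y \<in> set c" "{u, v} = {y, p y}"
          using uv unfolding x(2) edges_support[OF pp] by blast
        then show ?thesis using supV[OF x(1)] Rp(1)[of y] sym x(2) by (auto simp: doubleton_eq_iff)
      qed
      ultimately show ?thesis unfolding cyc_def by blast
    qed
    show "set c \<inter> set d = {}" if cd: "c \<in> \<C>" "d \<in> \<C>" "c \<noteq> d" for c d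
    proof -
      obtain x y where x: "c = support p x" and y: "d = support p y"
        using rep[OF cd(1)] rep[OF cd(2)] by blast
      have "set c \<noteq> set d" using same cd by blast
      then show ?thesis
        using disjoint_support[OF pp] unfolding x y disjoint_def by blast
    qed
    show "(\<Union>c\<in>\<C>. set c) = V"
    proof
      show "(\<Union>c\<in>\<C>. set c) \<subseteq> V" using rep supV by blast
      show "V \<subseteq> (\<Union>c\<in>\<C>. set c)" using cover in_support by blast
    qed
    \<comment> \<open>Exactly one of x and \<alpha> x satisfies \<open>Q\<close>, and
      \<open>p\<close> maps that one to the other.\<close>
    show "{x, \<alpha> x} \<in> (\<Union>c\<in>\<C>. edges c)" if x: "x \<in> V" for x
      using edge[OF x] edge[of "\<alpha> x"] \<alpha>[OF x] x by (auto simp: p_def insert_commute)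
    show "{x, \<beta> x} \<in> (\<Union>c\<in>\<C>. edges c)" if x: "x \<in> V" for x
      using edge[OF x] edge[of "\<beta> x"] \<beta>[OF x] x by (auto simp: p_def insert_commute)
  qed
qed

section \<open>The two matchings of the shell\<close>

definition dleft :: "dyck \<Rightarrow> dyck" where
  "dleft w = (case dmir w of Eps \<Rightarrow> Eps | Nd v u \<Rightarrow> dmir u)"

definition dright :: "dyck \<Rightarrow> dyck" where
  "dright w = (case dmir w of Eps \<Rightarrow> Eps | Nd v u \<Rightarrow> dmir v)"

lemma dleft_dsnoc [simp]: "dleft (dsnoc u v) = u" and dright_dsnoc [simp]: "dright (dsnoc u v) = v"
  by (auto simp: dleft_def dright_def)

text \<open>u 1 v 0 becomes 1 u 0 v: the root of the plane tree moves to its last child.\<close>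

definition drot :: "dyck \<Rightarrow> dyck" where
  "drot w = (if w = Eps then Eps else Nd (dleft w) (dright w))"

lemma drot_simps [simp]: "drot Eps = Eps" "drot (dsnoc u v) = Nd u v"
  by (auto simp: drot_def)

fun drot' :: "dyck \<Rightarrow> dyck" where
  "drot' Eps = Eps"
| "drot' (Nd u v) = dsnoc u v"

lemma drot_drot' [simp]: "drot (drot' w) = w"
  by (cases w) auto

lemma dmir_drot: "dmir (drot w) = drot' (dmir w)"
  by (cases w rule: dyck_dsnoc_cases) auto

lemma size_drot [simp]: "size (drot w) = size w" and size_drot' [simp]: "size (drot' w) = size w"
  by (cases w rule: dyck_dsnoc_cases; simp) (cases w; simp)

fun down :: "conf \<Rightarrow> conf" where
  "down (as, w, b # bs) = (w # as, b, bs)"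
| "down (as, w, []) = (as, w, [])"

fun up :: "conf \<Rightarrow> conf" where
  "up (a # as, w, bs) = (as, a, w # bs)"
| "up ([], w, bs) = ([], w, bs)"

text \<open>The matchings are given on the upper half of the levels and extended by \<^const>\<open>mir\<close>. The
  test \<open>Suc (length bs) = length as + 2 * l\<close> recognises the topmost of the \<open>2 * l\<close> levels. The first
  matching consists of every other edge of each chain.\<close>

fun alphaT :: "nat \<Rightarrow> conf \<Rightarrow> conf" where
  "alphaT l (as, w, bs) =
     (if as = [] \<or> Suc (length bs) = length as + 2 * l then down (as, w, bs) else up (as, w, bs))"

text \<open>If \<open>w\<close> is nonempty, the 1 that opens its last factor becomes 0 on the
  topmost level, and the 0 that closes its first factor becomes 1 on the others. If \<open>w\<close>
  is empty, these moves are undone, except that \<open>drot\<close> crosses the middle where undoing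
  fails: for \<open>as = []\<close> only one unmatched 1 is left, and for one word in
  \<open>as\<close> with \<open>l \<ge> 2\<close> the target is already matched with a vertex
  further down.\<close>

fun betaT :: "nat \<Rightarrow> conf \<Rightarrow> conf" where
  "betaT l (as, w, bs) =
     (let top = (Suc (length bs) = length as + 2 * l) in
      if w \<noteq> Eps then
        if top then (dright w # dleft w # as, Eps, bs)
        else (case w of Nd a b \<Rightarrow> (as, Eps, a # b # bs))
      else if \<not> top \<and> 2 \<le> length as then (drop 2 as, dsnoc (as ! 1) (as ! 0), bs)
      else if length bs = Suc (length as) \<and> (\<not> top \<or> as = []) then (drot (hd bs) # as, Eps, tl bs)
      else (as, Nd (bs ! 0) (bs ! 1), drop 2 bs))"

definition upper :: "conf \<Rightarrow> bool" where
  "upper c \<longleftrightarrow> (case c of (as, w, bs) \<Rightarrow> length as < length bs)"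

definition sym_ext :: "(conf \<Rightarrow> conf) \<Rightarrow> conf \<Rightarrow> conf" where
  "sym_ext g c = (if upper c then g c else mir (g (mir c)))"

abbreviation alpha :: "nat \<Rightarrow> conf \<Rightarrow> conf" where "alpha l \<equiv> sym_ext (alphaT l)"
abbreviation beta :: "nat \<Rightarrow> conf \<Rightarrow> conf" where "beta l \<equiv> sym_ext (betaT l)"

text \<open>The excess of 1s over 0s is \<open>length bs - length as\<close>, so \<open>window l\<close> describes the middle \<open>2 * l\<close>
  levels. The conditions of \<open>block l\<close> say that removing the two outermost words on each side leaves
  a member of \<open>window (l - 2)\<close>.\<close>

definition window :: "nat \<Rightarrow> conf \<Rightarrow> bool" where
  "window l c \<longleftrightarrow> (case c of (as, w, bs) \<Rightarrow> odd (length as + length bs) \<and>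
     length as < length bs + 2 * l \<and> length bs < length as + 2 * l)"

definition block :: "nat \<Rightarrow> conf \<Rightarrow> bool" where
  "block l c \<longleftrightarrow> (case c of (as, w, bs) \<Rightarrow> 2 \<le> length as \<and> 2 \<le> length bs \<and>
     length as + 5 \<le> length bs + 2 * l \<and> length bs + 5 \<le> length as + 2 * l)"

definition shell :: "nat \<Rightarrow> conf \<Rightarrow> bool" where
  "shell l c \<longleftrightarrow> window l c \<and> \<not> block l c"

lemma upper_mir: "window l c \<Longrightarrow> upper (mir c) \<longleftrightarrow> \<not> upper c"
  by (cases c) (auto simp: upper_def window_def not_less le_less)

lemma window_mir [simp]: "window l (mir c) = window l c"
  by (cases c) (auto simp: window_def add.commute)

lemma block_mir [simp]: "block l (mir c) = block l c"
  by (cases c) (auto simp: block_def)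

lemma shell_mir [simp]: "shell l (mir c) = shell l c"
  by (simp add: shell_def)

lemma sym_ext_mir: "window l c \<Longrightarrow> sym_ext g (mir c) = mir (sym_ext g c)"
  using upper_mir[of l c] by (auto simp: sym_ext_def)

lemma flip_appendL: "flip xs ys \<Longrightarrow> flip (us @ xs) (us @ ys)"
  using flip_append[of xs ys us "[]"] by simp

lemma flip_appendR: "flip xs ys \<Longrightarrow> flip (xs @ us) (ys @ us)"
  using flip_append[of xs ys "[]" us] by simp

lemma flip_Cons: "flip xs ys \<Longrightarrow> flip (x # xs) (x # ys)"
  using flip_appendL[of xs ys "[x]"] by simp

lemma flip_Cons_Not: "flip (True # xs) (False # xs)" "flip (False # xs) (True # xs)"
  by (rule flipI[of _ "[]" True xs]; simp) (rule flipI[of _ "[]" False xs]; simp)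

lemmas flip_intros = flip_appendL flip_Cons flip_Cons_Not flip_appendR

lemma cadj_down: "cadj (as, w, b # bs) (w # as, b, bs)"
  by (auto simp: cadj_def intro!: flip_intros)

lemma cadj_A: "cadj (as, dsnoc u v, bs) (v # u # as, Eps, bs)"
  by (auto simp: cadj_def intro!: flip_intros)

lemma cadj_B: "cadj (as, Eps, a # b # bs) (as, Nd a b, bs)"
  by (auto simp: cadj_def intro!: flip_intros)

lemma cadj_X: "cadj (as, Eps, q # bs) (drot q # as, Eps, bs)"
proof (cases q rule: dyck_dsnoc_cases)
  case (2 u v)
  have "flip (word0 as @ True # dword u @ True # (dword v @ False # word1 bs))
             (word0 as @ True # dword u @ False # (dword v @ False # word1 bs))"
    by (intro flip_intros)
  then show ?thesis using 2 by (simp add: cadj_def)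
qed (auto simp: cadj_def intro!: flip_intros)

lemma dyck_list_cases:
  fixes xs :: "dyck list"
  obtains "xs = []" | x where "xs = [x]" | x y ys where "xs = x # y # ys"
  by (cases xs; cases "tl xs"; auto)

text \<open>\<open>2 * k + 1\<close> is the excess of 1s, so \<open>k\<close> numbers the levels
  upwards from the middle. Above the middle the shell consists of the two topmost levels and of the
  words with at most one unmatched 0.\<close>

lemma shell_upper_iff:
  assumes "length as < length bs"
  shows "shell l (as, w, bs) \<longleftrightarrow>
    (\<exists>k<l. length bs = length as + 2 * k + 1 \<and> (length as < 2 \<or> l \<le> k + 2))"
proof
  assume s: "shell l (as, w, bs)"
  then have "odd (length bs - length as)" using assms by (simp add: shell_def window_def)
  then obtain k where "length bs - length as = 2 * k + 1" by (rule oddE)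
  then have "length bs = length as + 2 * k + 1" using assms by linarith
  then show "\<exists>k<l. length bs = length as + 2 * k + 1 \<and> (length as < 2 \<or> l \<le> k + 2)"
    using s by (intro exI[of _ k]) (auto simp: shell_def window_def block_def)
qed (auto simp: shell_def window_def block_def)

lemma shell_lower_iff:
  assumes "length bs < length as"
  shows "shell l (as, w, bs) \<longleftrightarrow>
    (\<exists>k<l. length as = length bs + 2 * k + 1 \<and> (length bs < 2 \<or> l \<le> k + 2))"
  using shell_upper_iff[of "map dmir bs" "map dmir as" l "dmir w"] shell_mir[of l "(as, w, bs)"] assms
  by simp

section \<open>Both rules are involutions of the shell along edges\<close>

definition matches :: "nat \<Rightarrow> (conf \<Rightarrow> conf) \<Rightarrow> conf \<Rightarrow> bool" where
  "matches l g c \<longleftrightarrow> g (g c) = c \<and> shell l (g c) \<and> len (g c) = len c \<and> cadj c (g c)"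

lemma alpha_upper:
  assumes "shell l (as, w, bs)" "length as < length bs"
  shows "matches l (alpha l) (as, w, bs)"
proof -
  obtain k where k: "k < l" "length bs = length as + 2 * k + 1" "length as < 2 \<or> l \<le> k + 2"
    using assms shell_upper_iff by blast
  show ?thesis
  proof (cases "as = [] \<or> Suc (length bs) = length as + 2 * l")
    case True
    obtain b bs' where bs: "bs = b # bs'" using k by (cases bs) auto
    have 1: "alpha l (as, w, bs) = (w # as, b, bs')"
      using True assms(2) bs by (auto simp: sym_ext_def upper_def)
    have 2: "alpha l (w # as, b, bs') = (as, w, bs)"
      using True k bs by (cases k) (auto simp: sym_ext_def upper_def o_def)
    have 3: "shell l (w # as, b, bs')"
    proof (cases k)
      case 0
      then show ?thesis using True k bs by (subst shell_lower_iff) auto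
    next
      case (Suc k')
      then show ?thesis using True k bs by (subst shell_upper_iff) auto
    qed
    show ?thesis unfolding matches_def 1 2 using 3 bs cadj_down by auto
  next
    case False
    then obtain a as' where as: "as = a # as'" by (cases as) auto
    have 1: "alpha l (as, w, bs) = (as', a, w # bs)"
      using False assms(2) as by (auto simp: sym_ext_def upper_def)
    have "as' = [] \<or> l = k + 2" using False k as by auto
    then have 2: "alpha l (as', a, w # bs) = (as, w, bs)"
      using False k as by (auto simp: sym_ext_def upper_def)
    have 3: "shell l (as', a, w # bs)"
      using False k as by (subst shell_upper_iff) (auto intro!: exI[of _ "Suc k"])
    show ?thesis unfolding matches_def 1 2 using 3 as cadj_down cadj_sym by auto
  qed
qed

lemma beta_upper:
  assumes "shell l (as, w, bs)" "length as < length bs"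
  shows "matches l (beta l) (as, w, bs)"
proof -
  obtain k where k: "k < l" "length bs = length as + 2 * k + 1" "length as < 2 \<or> l \<le> k + 2"
    using assms shell_upper_iff by blast
  let ?top = "Suc (length bs) = length as + 2 * l"
  have top: "?top \<longleftrightarrow> l = Suc k" using k by auto
  \<comment> \<open>\<open>A'\<close> and \<open>B'\<close> undo \<open>A\<close> and
    \<open>B\<close>, and \<open>X\<close> crosses the middle. \<open>A\<close> and \<open>B\<close>
    leave the upper half only if \<open>k = 0\<close>, hence \<open>l = 1\<close>; there they are
    mirror images and undo each other.\<close>
  consider (A) u v where "w = dsnoc u v" "l = Suc k" | (A') x y as' where "w = Eps" "l \<noteq> Suc k" "as = x # y # as'"
    | (B') a b where "w = Nd a b" "l \<noteq> Suc k"
    | (X) q bs' where "w = Eps" "k = 0" "l \<noteq> Suc k \<and> length as < 2 \<or> as = []" "bs = q # bs'"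
    | (B) a b bs' where "w = Eps" "l = Suc k \<or> length as < 2" "k > 0 \<or> l = 1 \<and> as \<noteq> []" "bs = a # b # bs'"
  proof (cases "w = Eps")
    case False
    then show thesis using A B' by (metis dyck.exhaust dyck_dsnoc_cases)
  next
    case True
    show thesis
    proof (cases "l \<noteq> Suc k \<and> 2 \<le> length as")
      case True
      then show thesis using A' \<open>w = Eps\<close> by (cases as rule: dyck_list_cases) auto
    next
      case c: False
      show thesis
      proof (cases "k = 0 \<and> (l \<noteq> Suc k \<or> as = [])")
        case True
        then show thesis using X c k \<open>w = Eps\<close> by (cases bs) auto
      next
        case False
        then have *: "k > 0 \<or> l = 1 \<and> as \<noteq> []" "l = Suc k \<or> length as < 2" using c by auto
        then have "2 \<le> length bs" using k by (cases as) auto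
        then obtain a b bs' where "bs = a # b # bs'" by (cases bs rule: dyck_list_cases) auto
        then show thesis using * \<open>w = Eps\<close> by (intro B)
      qed
    qed
  qed
  then show ?thesis
  proof cases
    case A
    have 1: "beta l (as, w, bs) = (v # u # as, Eps, bs)"
      using A k by (auto simp: sym_ext_def upper_def)
    have 2: "beta l (v # u # as, Eps, bs) = (as, w, bs)"
      using A k by (cases k) (auto simp: sym_ext_def upper_def o_def)
    have 3: "shell l (v # u # as, Eps, bs)"
    proof (cases k)
      case 0
      then show ?thesis using A k by (subst shell_lower_iff) auto
    next
      case (Suc k')
      then show ?thesis using A k by (subst shell_upper_iff) auto
    qed
    show ?thesis unfolding matches_def 1 2 using 3 A cadj_A by auto
  next
    case A'
    have 1: "beta l (as, w, bs) = (as', dsnoc y x, bs)"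
      using A' k by (auto simp: sym_ext_def upper_def)
    have 2: "beta l (as', dsnoc y x, bs) = (as, w, bs)"
      using A' k by (auto simp: sym_ext_def upper_def)
    have 3: "shell l (as', dsnoc y x, bs)"
      using A' k by (subst shell_upper_iff) (auto intro!: exI[of _ "Suc k"])
    show ?thesis unfolding matches_def 1 2 using 3 A' cadj_A cadj_sym by auto
  next
    case B'
    have 1: "beta l (as, w, bs) = (as, Eps, a # b # bs)"
      using B' k by (auto simp: sym_ext_def upper_def)
    have 2: "beta l (as, Eps, a # b # bs) = (as, w, bs)"
      using B' k by (auto simp: sym_ext_def upper_def)
    have 3: "shell l (as, Eps, a # b # bs)"
      using B' k by (subst shell_upper_iff) (auto intro!: exI[of _ "Suc k"])
    show ?thesis unfolding matches_def 1 2 using 3 B' cadj_B cadj_sym by auto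
  next
    case X
    have 1: "beta l (as, w, bs) = (drot q # as, Eps, bs')"
      using X k by (auto simp: sym_ext_def upper_def)
    have 2: "beta l (drot q # as, Eps, bs') = (as, w, bs)"
      using X k by (auto simp: sym_ext_def upper_def o_def dmir_drot)
    have 3: "shell l (drot q # as, Eps, bs')"
      using X k by (subst shell_lower_iff) auto
    show ?thesis unfolding matches_def 1 2 using 3 X cadj_X by auto
  next
    case B
    have 1: "beta l (as, w, bs) = (as, Nd a b, bs')"
      using B k by (auto simp: sym_ext_def upper_def)
    have 2: "beta l (as, Nd a b, bs') = (as, w, bs)"
      using B k by (cases k) (auto simp: sym_ext_def upper_def o_def)
    have 3: "shell l (as, Nd a b, bs')"
    proof (cases k)
      case 0
      then show ?thesis using B k by (subst shell_lower_iff) auto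
    next
      case (Suc k')
      then show ?thesis using B k by (subst shell_upper_iff) auto
    qed
    show ?thesis unfolding matches_def 1 2 using 3 B cadj_B by auto
  qed
qed

lemma matches_sym_ext:
  assumes "\<And>as w bs. shell l (as, w, bs) \<Longrightarrow> length as < length bs \<Longrightarrow> matches l (sym_ext g) (as, w, bs)"
    and "shell l c"
  shows "matches l (sym_ext g) c"
proof (cases "upper c")
  case True
  then show ?thesis using assms by (cases c) (auto simp: upper_def)
next
  case False
  then have "upper (mir c)" using assms upper_mir shell_def by blast
  then have *: "matches l (sym_ext g) (mir c)"
    using assms(1)[of "fst (mir c)" "fst (snd (mir c))" "snd (snd (mir c))"] assms(2)
    by (auto simp: upper_def split: prod.splits)
  have "window l c" using assms by (simp add: shell_def)
  then have eq: "sym_ext g (mir c) = mir (sym_ext g c)" by (rule sym_ext_mir)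
  then have "shell l (sym_ext g c)" using * by (simp add: matches_def)
  then have "sym_ext g (mir (sym_ext g c)) = mir (sym_ext g (sym_ext g c))"
    by (intro sym_ext_mir[of l]) (simp add: shell_def)
  then show ?thesis using * eq unfolding matches_def by (metis cadj_mir_iff len_mir mir_mir shell_mir)
qed

lemma matches_alpha: "shell l c \<Longrightarrow> matches l (alpha l) c"
  and matches_beta: "shell l c \<Longrightarrow> matches l (beta l) c"
  using matches_sym_ext alpha_upper beta_upper by blast+

section \<open>Functions that are constant along both matchings\<close>

text \<open>All lengths are treated at once, which spares the path lemmas any condition on sizes;
  lengths are told apart by the values of \<open>f\<close>.\<close>

definition invariant :: "nat \<Rightarrow> (conf \<Rightarrow> 'a) \<Rightarrow> bool" where
  "invariant l f \<longleftrightarrow> (\<forall>c. shell l c \<longrightarrow> f (alpha l c) = f c \<and> f (beta l c) = f c)"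

lemma inv_mir: "invariant l f \<Longrightarrow> invariant l (\<lambda>c. f (mir c))"
  unfolding invariant_def shell_def by (metis sym_ext_mir window_mir block_mir)

lemma inv_alpha: "invariant l f \<Longrightarrow> shell l c \<Longrightarrow> alpha l c = d \<Longrightarrow> f c = f d"
  and inv_beta: "invariant l f \<Longrightarrow> shell l c \<Longrightarrow> beta l c = d \<Longrightarrow> f c = f d"
  by (metis invariant_def)+

lemma shell_topI: "Suc (length bs) = length as + 2 * l \<Longrightarrow> length as < length bs \<Longrightarrow> shell l (as, w, bs)"
  by (subst shell_upper_iff) (auto intro!: exI[of _ "l - 1"])

lemma shell_01I:
  "length as < 2 \<Longrightarrow> length bs = length as + 2 * k + 1 \<Longrightarrow> k < l \<Longrightarrow> shell l (as, w, bs)"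
  by (subst shell_upper_iff) auto

context
  fixes l :: nat and f :: "conf \<Rightarrow> 'a"
  assumes inv: "invariant l f" and l: "1 \<le> l"
begin

lemma inv_down_top: "length bs + 2 = length as + 2 * l \<Longrightarrow> f (as, w, b # bs) = f (w # as, b, bs)"
  using l by (intro inv_alpha[OF inv shell_topI]) (auto simp: sym_ext_def upper_def)

lemma inv_A: "length bs + 1 = length as + 2 * l \<Longrightarrow> f (as, dsnoc u v, bs) = f (v # u # as, Eps, bs)"
  using l by (intro inv_beta[OF inv shell_topI]) (auto simp: sym_ext_def upper_def)

lemma inv_B_top: "length bs + 3 = length as + 2 * l \<Longrightarrow> f (as, Eps, a # b # bs) = f (as, Nd a b, bs)"
  using l by (intro inv_beta[OF inv shell_topI]) (auto simp: sym_ext_def upper_def)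

lemma inv_down0: "length bs = 2 * j \<Longrightarrow> j < l \<Longrightarrow> f ([], w, b # bs) = f ([w], b, bs)"
  by (intro inv_alpha[OF inv shell_01I[of _ _ j]]) (auto simp: sym_ext_def upper_def)

lemma inv_B0: "length bs = 2 * j + 1 \<Longrightarrow> j + 1 < l \<Longrightarrow> f ([], Eps, a # b # bs) = f ([], Nd a b, bs)"
  by (intro inv_beta[OF inv shell_01I[of _ _ "Suc j"]]) (auto simp: sym_ext_def upper_def)

lemma inv_B1: "length bs = 2 * j \<Longrightarrow> 1 \<le> j \<Longrightarrow> j < l \<Longrightarrow> f ([x], Eps, a # b # bs) = f ([x], Nd a b, bs)"
  by (intro inv_beta[OF inv shell_01I[of _ _ j]]) (auto simp: sym_ext_def upper_def)

lemma inv_X0: "f ([], Eps, [q]) = f ([drot q], Eps, [])"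
  using l by (intro inv_beta[OF inv shell_01I[of _ _ 0]]) (auto simp: sym_ext_def upper_def)

lemma inv_X1: "2 \<le> l \<Longrightarrow> f ([x], Eps, [q, s]) = f ([drot q, x], Eps, [s])"
  by (intro inv_beta[OF inv shell_01I[of _ _ 0]]) (auto simp: sym_ext_def upper_def)

text \<open>In the topmost level the path of the two matchings carries the word before the first unmatched
  1 across that 1.\<close>

lemma inv_shift:
  "length bs + 2 = length as + 2 * l \<Longrightarrow> f (as, w, b # bs) = f (as, Eps, dapp w b # bs)"
proof (induction "size w" arbitrary: as w b bs rule: less_induct)
  case less
  show ?case
  proof (cases w rule: dyck_dsnoc_cases)
    case 1
    then show ?thesis by simp
  next
    case (2 u v)
    have "f (as, dsnoc u v, b # bs) = f (v # u # as, Eps, b # bs)"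
      using less.prems by (intro inv_A) simp
    also have "\<dots> = f (u # as, v, Eps # b # bs)"
      using less.prems by (intro inv_down_top[symmetric]) simp
    also have "\<dots> = f (u # as, Eps, v # b # bs)"
      using less.hyps[of v "b # bs" "u # as" Eps] 2 less.prems by simp
    also have "\<dots> = f (u # as, Nd v b, bs)"
      using less.prems by (intro inv_B_top) simp
    also have "\<dots> = f (as, u, Nd v b # bs)"
      using less.prems by (intro inv_down_top[symmetric]) simp
    also have "\<dots> = f (as, Eps, dapp u (Nd v b) # bs)"
      using less.hyps[of u bs as "Nd v b"] 2 less.prems by simp
    finally show ?thesis using 2 by (simp add: dapp_dsnoc)
  qed
qed

lemma inv_unfold:
  assumes "length bs + 3 = length as + 2 * l"
  shows "f (as, w, b # b' # bs) = f (as, Nd (dapp w b) b', bs)"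
  using inv_shift[of "b' # bs" as w b] inv_B_top[OF assms] assms by simp

text \<open>Each round uses up one unmatched 0: \<open>inv_unfold\<close> leads one level down, and
  the chain edge back to the topmost level turns a 0 into a 1.\<close>

lemma inv_top_reaches:
  assumes "Suc (length bs) = length as + 2 * l" "length as < length bs"
  shows "\<exists>b bs'. f (as, w, bs) = f ([], Eps, b # bs') \<and> length bs' + 2 = 2 * l"
  using assms
proof (induction as arbitrary: w bs)
  case Nil
  then obtain b bs' where "bs = b # bs'" by (cases bs) auto
  then show ?case using Nil inv_shift[of bs' "[]" w b] by auto
next
  case (Cons a as)
  then obtain b b' bs' where bs: "bs = b # b' # bs'" by (cases bs rule: dyck_list_cases) auto
  have "f (a # as, w, bs) = f (a # as, Nd (dapp w b) b', bs')"
    unfolding bs using Cons.prems bs by (intro inv_unfold) simp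
  also have "\<dots> = f (as, a, Nd (dapp w b) b' # bs')"
    using Cons.prems bs by (intro inv_down_top[symmetric]) simp
  finally show ?case using Cons.IH[of "Nd (dapp w b) b' # bs'" a] Cons.prems bs l by simp
qed

end

section \<open>Plane trees up to rotation, and the middle two levels\<close>

text \<open>Rotation brings a leaf to the front, so it suffices to treat
  \<open>\<lambda>u. F (Nd Eps u)\<close> on smaller trees. It satisfies the same hypotheses: its
  rotation is a rotation of \<open>F\<close> followed by a pull. This is why \<open>F\<close> is
  generalised in the induction.\<close>

lemma rotation_invariant_const:
  fixes F :: "dyck \<Rightarrow> 'a"
  assumes rot: "\<And>u v. F (dsnoc u v) = F (Nd u v)"
    and pull: "\<And>u v. F (Nd (Nd Eps u) v) = F (Nd Eps (Nd u v))"
    and "size w = size w'"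
  shows "F w = F w'"
  using assms
proof (induction "size w" arbitrary: F w w')
  case 0
  then show ?case by simp
next
  case (Suc n)
  note rot = Suc.prems(1) and pull = Suc.prems(2)
  have comm: "F (dapp u v) = F (dapp v u)" for u v
  proof (induction u arbitrary: v)
    case (Nd a u)
    have "F (dapp (Nd a u) v) = F (dapp a (Nd (dapp u v) Eps))"
      using rot[of a "dapp u v"] by (simp add: dsnoc_conv_dapp)
    also have "\<dots> = F (Nd (dapp u v) a)" using Nd.IH(1) by simp
    also have "\<dots> = F (dapp u (dapp v (Nd a Eps)))"
      using rot[of "dapp u v" a] by (simp add: dsnoc_conv_dapp dapp_assoc)
    also have "\<dots> = F (dapp v (Nd a u))" using Nd.IH(2) by (simp add: dapp_assoc)
    finally show ?case .
  qed simp
  have leaf: "\<exists>w'. F (Nd a b) = F (Nd Eps w') \<and> size w' = size a + size b" for a b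
  proof (induction "size a" arbitrary: a b rule: less_induct)
    case less
    show ?case
    proof (cases a)
      case (Nd c d)
      have "F (Nd a b) = F (Nd c (dsnoc d b))" using rot[of a b] Nd by simp
      then show ?thesis using less[of c "dsnoc d b"] Nd by auto
    qed auto
  qed
  have const: "F (Nd Eps u) = F (Nd Eps u')" if "size u = n" "size u = size u'" for u u'
  proof (rule Suc.hyps(1)[of u "\<lambda>x. F (Nd Eps x)" u'])
    show "n = size u" "size u = size u'" using that by auto
    show "F (Nd Eps (dsnoc u v)) = F (Nd Eps (Nd u v))" for u v
      using rot[of "Nd Eps u" v] pull[of u v] by simp
    \<comment> \<open>The leaf in front is moved to the far end by \<open>comm\<close>, so that
      \<open>pull\<close> applies at the root, and then moved back.\<close>
    show "F (Nd Eps (Nd (Nd Eps u) v)) = F (Nd Eps (Nd Eps (Nd u v)))" for u v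
    proof -
      have "F (Nd Eps (Nd (Nd Eps u) v)) = F (Nd (Nd Eps u) (dapp v (Nd Eps Eps)))"
        using comm[of "Nd Eps Eps" "Nd (Nd Eps u) v"] by simp
      also have "\<dots> = F (Nd Eps (Nd u (dapp v (Nd Eps Eps))))" by (rule pull)
      also have "\<dots> = F (Nd Eps (Nd Eps (Nd u v)))"
        using comm[of "Nd Eps Eps" "Nd Eps (Nd u v)"] by simp
      finally show ?thesis .
    qed
  qed
  obtain a b a' b' where w: "w = Nd a b" "w' = Nd a' b'"
    using Suc.hyps(2) Suc.prems(3) by (cases w; cases w') auto
  obtain u u' where "F w = F (Nd Eps u)" "size u = n" "F w' = F (Nd Eps u')" "size u' = n"
    using leaf[of a b] leaf[of a' b'] w Suc.hyps(2) Suc.prems(3) by auto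
  then show ?case using const by metis
qed

text \<open>Crossing the middle by the second matching rotates the tree \<open>b\<close> of
  \<open>([], Eps, [b])\<close>, and the way back by \<open>inv_shift\<close> leaves it as it is;
  the hexagons supply the pulls. Assumption \<open>len\<close> recovers the sizes of the trees
  reached.\<close>

lemma inv_1_const:
  assumes inv: "invariant 1 f" and len: "\<And>c d. f c = f d \<Longrightarrow> len c = len d"
    and hex: "\<And>u v. f ([Nd (Nd Eps u) v], Eps, []) = f ([Nd Eps (Nd u v)], Eps, [])"
    and "shell 1 c" "shell 1 d" "len c = len d"
  shows "f c = f d"
proof -
  let ?F = "\<lambda>b. f ([], Eps, [b])"
  have x: "?F (dsnoc u v) = f ([Nd u v], Eps, [])" for u v
    using inv_X0[OF inv, of "dsnoc u v"] by simp
  have y: "f ([w], Eps, []) = ?F w" for w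
    using inv_down0[OF inv, of "[]" 0 w Eps] inv_shift[OF inv, of "[]" "[]" w Eps] by simp
  have const: "?F w = ?F w'" if "size w = size w'" for w w'
  proof (rule rotation_invariant_const[of ?F])
    show "?F (dsnoc u v) = ?F (Nd u v)" for u v unfolding x[of u v] by (rule y)
    show "?F (Nd (Nd Eps u) v) = ?F (Nd Eps (Nd u v))" for u v
      unfolding y[symmetric] by (rule hex)
    show "size w = size w'" by (rule that)
  qed
  have reach: "\<exists>b. f c = ?F b" if "shell 1 c" for c
  proof -
    have up: "\<exists>b. f c = ?F b" if c: "shell 1 c" "upper c" for c
    proof -
      obtain as w bs where c': "c = (as, w, bs)" by (cases c)
      have "Suc (length bs) = length as + 2 * 1" "length as < length bs"
        using c c' by (auto simp: shell_def window_def upper_def)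
      then show ?thesis using inv_top_reaches[OF inv, of bs as w] c' by auto
    qed
    show ?thesis
    proof (cases "upper c")
      case True
      then show ?thesis using up that by blast
    next
      case False
      obtain as w bs where c: "c = (as, w, bs)" by (cases c)
      have "length as \<noteq> length bs" "length as < length bs + 2" "\<not> length as < length bs"
        using that False c by (auto simp: shell_def window_def upper_def)
      then have 1: "length as = Suc (length bs)" by linarith
      then obtain a as' where as: "as = a # as'" by (cases as) auto
      have "shell 1 (as', a, w # bs)" "upper (as', a, w # bs)"
        using 1 as by (auto simp: shell_def window_def block_def upper_def)
      moreover have "f (as', a, w # bs) = f c"
        using inv_down_top[OF inv, of bs as' a w] 1 as c by simp
      ultimately show ?thesis using up by metis
    qed
  qed
  obtain b b' where "f c = ?F b" "f d = ?F b'" using reach assms by metis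
  moreover from this have "size b = size b'" using len[of c "([], Eps, [b])"] len[of d "([], Eps, [b'])"] assms by auto
  ultimately show ?thesis using const by metis
qed

section \<open>At least four levels: paths above the middle\<close>

text \<open>Here \<open>j\<close> fixes the level. The word \<open>p'\<close> must not depend on \<open>s\<close>: this is what permits the
  induction in \<open>inv_const\<close> below.\<close>

definition paths_down :: "(conf \<Rightarrow> 'a) \<Rightarrow> nat \<Rightarrow> bool" where
  "paths_down f j \<longleftrightarrow> (\<forall>p q. \<exists>p'. size p' = size p \<and>
     (\<forall>s bs. length bs = 2 * j \<longrightarrow> f ([p], Eps, q # s # bs) = f ([], Nd p' q, s # bs)))"

definition paths_up :: "(conf \<Rightarrow> 'a) \<Rightarrow> nat \<Rightarrow> bool" where
  "paths_up f j \<longleftrightarrow> (\<forall>a q. \<exists>p. size p = size a \<and>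
     (\<forall>s bs. length bs = 2 * j \<longrightarrow> f ([], Nd a q, s # bs) = f ([p], Eps, q # s # bs)))"

context
  fixes l :: nat and f :: "conf \<Rightarrow> 'a"
  assumes inv: "invariant l f" and l: "2 \<le> l"
begin

lemma l1: "1 \<le> l" using l by simp

text \<open>One chain edge up to the topmost level and \<open>inv_unfold\<close> back down; at this
  height the word itself survives.\<close>

lemma paths_base: "paths_down f (l - 2)" "paths_up f (l - 2)"
proof -
  have *: "f ([p], Eps, q # s # bs) = f ([], Nd p q, s # bs)" if "length bs = 2 * (l - 2)" for p q s bs
  proof -
    have "f ([p], Eps, q # s # bs) = f ([], p, Eps # q # s # bs)"
      using that l inv_down0[OF inv l1, of "q # s # bs" "l - 1"] by auto
    also have "\<dots> = f ([], Nd p q, s # bs)"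
      using that l inv_unfold[OF inv l1, of "s # bs" "[]" p Eps q] by auto
    finally show ?thesis .
  qed
  show "paths_down f (l - 2)" unfolding paths_down_def using * by blast
  show "paths_up f (l - 2)" unfolding paths_up_def using * by metis
qed

text \<open>The counterpart of \<open>inv_shift\<close> on lower levels, where only sizes are
  retained. Each round replaces \<open>p = Nd a c\<close> by a word of the size of \<open>a\<close>
  and packs the rest together with \<open>b\<close> into \<open>Nd c b\<close>.\<close>

lemma sweep:
  assumes "paths_up f (Suc j)" "Suc j < l"
  shows "\<exists>b'. size b' = size p + size b \<and>
    (\<forall>bs. length bs = 2 * j + 2 \<longrightarrow> f ([], p, b # bs) = f ([], Eps, b' # bs))"
proof (induction "size p" arbitrary: p b rule: less_induct)
  case less
  show ?case
  proof (cases p)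
    case Eps
    then show ?thesis by auto
  next
    case (Nd a c)
    obtain p' where p': "size p' = size a"
      "\<And>s bs. length bs = 2 * Suc j \<Longrightarrow> f ([], Nd a c, s # bs) = f ([p'], Eps, c # s # bs)"
      using assms(1) unfolding paths_up_def by metis
    obtain b' where b': "size b' = size p' + size (Nd c b)"
      "\<And>bs. length bs = 2 * j + 2 \<Longrightarrow> f ([], p', Nd c b # bs) = f ([], Eps, b' # bs)"
      using less[of p' "Nd c b"] p'(1) Nd by auto
    have "f ([], p, b # bs) = f ([], Eps, b' # bs)" if bs: "length bs = 2 * j + 2" for bs
    proof -
      have "f ([], p, b # bs) = f ([p'], Eps, c # b # bs)" using p'(2) bs Nd by simp
      also have "\<dots> = f ([p'], Nd c b, bs)"
        using bs assms(2) by (intro inv_B1[OF inv l1, of _ "Suc j"]) auto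
      also have "\<dots> = f ([], p', Nd c b # bs)"
        using bs assms(2) by (intro inv_down0[OF inv l1, of _ "Suc j", symmetric]) auto
      finally show ?thesis using b'(2) bs by simp
    qed
    then show ?thesis using b'(1) p'(1) Nd by (intro exI[of _ b']) auto
  qed
qed

lemma sweep':
  assumes "paths_down f (Suc j)" "Suc j < l"
  shows "\<exists>z. size z = size x + size y \<and>
    (\<forall>bs. length bs = 2 * j + 2 \<longrightarrow> f ([], y, x # bs) = f ([], z, Eps # bs))"
proof (induction "size x" arbitrary: x y rule: less_induct)
  case less
  show ?case
  proof (cases x)
    case Eps
    then show ?thesis by auto
  next
    case (Nd c b)
    obtain y' where y': "size y' = size y"
      "\<And>s bs. length bs = 2 * Suc j \<Longrightarrow> f ([y], Eps, c # s # bs) = f ([], Nd y' c, s # bs)"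
      using assms(1) unfolding paths_down_def by metis
    obtain z where z: "size z = size b + size (Nd y' c)"
      "\<And>bs. length bs = 2 * j + 2 \<Longrightarrow> f ([], Nd y' c, b # bs) = f ([], z, Eps # bs)"
      using less[of b "Nd y' c"] Nd by auto
    have "f ([], y, x # bs) = f ([], z, Eps # bs)" if bs: "length bs = 2 * j + 2" for bs
    proof -
      have "f ([], y, x # bs) = f ([y], x, bs)"
        using bs assms(2) by (intro inv_down0[OF inv l1, of _ "Suc j"]) auto
      also have "\<dots> = f ([y], Eps, c # b # bs)"
        using bs assms(2) Nd inv_B1[OF inv l1, of bs "Suc j" y c b] by auto
      also have "\<dots> = f ([], Nd y' c, b # bs)" using y'(2) bs by simp
      finally show ?thesis using z(2) bs by simp
    qed
    then show ?thesis using z(1) y'(1) Nd by (intro exI[of _ z]) auto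
  qed
qed

text \<open>A path at height \<open>j\<close> makes an excursion to height \<open>j + 1\<close>: a
  chain edge up, a sweep that carries everything across the first unmatched 1, and an edge of the
  second matching down. For \<open>paths_up\<close> it is run backwards.\<close>

lemma paths_step:
  assumes "paths_down f (Suc j)" "paths_up f (Suc j)" "Suc j < l"
  shows "paths_down f j" "paths_up f j"
proof -
  show "paths_down f j" unfolding paths_down_def
  proof (intro allI)
    fix p q
    obtain b' where b': "size b' = size p"
      "\<And>bs. length bs = 2 * j + 2 \<Longrightarrow> f ([], p, Eps # bs) = f ([], Eps, b' # bs)"
      using sweep[OF assms(2,3), of p Eps] by auto
    have "f ([p], Eps, q # s # bs) = f ([], Nd b' q, s # bs)" if bs: "length bs = 2 * j" for s bs
    proof -
      have "f ([p], Eps, q # s # bs) = f ([], p, Eps # q # s # bs)"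
        using bs assms(3) by (intro inv_down0[OF inv l1, of _ "Suc j", symmetric]) auto
      also have "\<dots> = f ([], Eps, b' # q # s # bs)" using b'(2) bs by simp
      also have "\<dots> = f ([], Nd b' q, s # bs)"
        using bs assms(3) by (intro inv_B0[OF inv l1, of _ j]) auto
      finally show ?thesis .
    qed
    then show "\<exists>p'. size p' = size p \<and>
     (\<forall>s bs. length bs = 2 * j \<longrightarrow> f ([p], Eps, q # s # bs) = f ([], Nd p' q, s # bs))"
      using b'(1) by blast
  qed
  show "paths_up f j" unfolding paths_up_def
  proof (intro allI)
    fix a q
    obtain z where z: "size z = size a"
      "\<And>bs. length bs = 2 * j + 2 \<Longrightarrow> f ([], Eps, a # bs) = f ([], z, Eps # bs)"
      using sweep'[OF assms(1,3), of a Eps] by auto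
    have "f ([], Nd a q, s # bs) = f ([z], Eps, q # s # bs)" if bs: "length bs = 2 * j" for s bs
    proof -
      have "f ([], Nd a q, s # bs) = f ([], Eps, a # q # s # bs)"
        using bs assms(3) by (intro inv_B0[OF inv l1, of _ j, symmetric]) auto
      also have "\<dots> = f ([], z, Eps # q # s # bs)" using z(2) bs by simp
      also have "\<dots> = f ([z], Eps, q # s # bs)"
        using bs assms(3) by (intro inv_down0[OF inv l1, of _ "Suc j"]) auto
      finally show ?thesis .
    qed
    then show "\<exists>p. size p = size a \<and>
     (\<forall>s bs. length bs = 2 * j \<longrightarrow> f ([], Nd a q, s # bs) = f ([p], Eps, q # s # bs))"
      using z(1) by blast
  qed
qed

lemma paths:
  assumes "j + 2 \<le> l"
  shows "paths_down f j \<and> paths_up f j"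
proof -
  have "j \<le> l - 2" using assms by simp
  then show ?thesis
  proof (induction rule: inc_induct)
    case base
    show ?case using paths_base by blast
  next
    case (step j)
    then show ?case using paths_step[of j] by auto
  qed
qed

text \<open>A sweep empties \<open>w\<close>, after which the second matching leads one level down
  at the cost of two unmatched 1s. The end is the upper vertex of a chain of length two.\<close>

lemma no_zeros_reaches:
  "length bs = 2 * j + 1 \<Longrightarrow> j + 2 \<le> l \<Longrightarrow> \<exists>w' s. f ([], w, bs) = f ([], w', [s])"
proof (induction j arbitrary: w bs)
  case 0
  then show ?case by (cases bs) auto
next
  case (Suc j)
  then obtain b q bs' where bs: "bs = b # q # bs'" by (cases bs rule: dyck_list_cases) auto
  obtain b' where "f ([], w, bs) = f ([], Eps, b' # q # bs')"
    using sweep[of j w b] paths[of "Suc j"] Suc.prems bs by auto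
  also have "\<dots> = f ([], Nd b' q, bs')"
    using Suc.prems bs by (intro inv_B0[OF inv l1, of _ j]) auto
  finally show ?case using Suc.IH[of bs' "Nd b' q"] Suc.prems bs by simp
qed

lemma top_reaches:
  assumes "Suc (length bs) = length as + 2 * l" "length as < length bs"
  shows "\<exists>w' s. f (as, w, bs) = f ([], w', [s])"
proof -
  obtain b bs' where *: "f (as, w, bs) = f ([], Eps, b # bs')" "length bs' + 2 = 2 * l"
    using inv_top_reaches[OF inv l1 assms] by blast
  then obtain b' bs'' where bs': "bs' = b' # bs''" using l by (cases bs') auto
  have "f ([], Eps, b # bs') = f ([], Nd b b', bs'')"
    unfolding bs' using * bs' l by (intro inv_B0[OF inv l1, of _ "l - 2"]) auto
  then show ?thesis using * no_zeros_reaches[of bs'' "l - 2" "Nd b b'"] bs' l by auto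
qed

lemma upper_reaches:
  assumes "shell l (as, w, bs)" "length as < length bs"
  shows "\<exists>w' s. f (as, w, bs) = f ([], w', [s])"
proof -
  obtain k where k: "k < l" "length bs = length as + 2 * k + 1" "length as < 2 \<or> l \<le> k + 2"
    using assms shell_upper_iff by blast
  show ?thesis
  proof (cases "l = Suc k")
    case True
    then show ?thesis using k by (intro top_reaches) auto
  next
    case False
    show ?thesis
    proof (cases as)
      case Nil
      then show ?thesis using no_zeros_reaches[of bs k w] k False by auto
    next
      case (Cons a as')
      have up: "f (as, w, bs) = f (as', a, w # bs)"
      proof (cases "as' = []")
        case True
        then show ?thesis
          using inv_down0[OF inv l1, of bs "Suc k" a w] k False Cons by auto
      next
        case neq: False
        then have "l = k + 2" using k False Cons by (cases as') auto
        then show ?thesis using inv_down_top[OF inv l1, of bs as' a w] k Cons by auto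
      qed
      show ?thesis
      proof (cases "l = k + 2")
        case True
        then show ?thesis using up top_reaches[of "w # bs" as' a] k Cons by auto
      next
        case neq: False
        then have "as' = []" using k False Cons by (cases as') auto
        then show ?thesis using up no_zeros_reaches[of "w # bs" "Suc k" a] k Cons neq False by auto
      qed
    qed
  qed
qed

lemma X_link: "f ([], Eps, [dsnoc u v]) = f ([], Nd u v, [Eps])"
  using inv_X0[OF inv l1, of "dsnoc u v"] inv_down0[OF inv l1, of "[]" 0 "Nd u v" Eps] l by simp

end

section \<open>Reduction to two Dyck words\<close>

lemma lower_reaches:
  assumes inv: "invariant l f" and l: "2 \<le> l" and "shell l (as, w, bs)" "length bs < length as"
  shows "\<exists>w' s. f (as, w, bs) = f ([], w', [s])"
proof -
  obtain w' s where "f (mir (mir (as, w, bs))) = f (mir ([], w', [s]))"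
    using upper_reaches[OF inv_mir[OF inv] l, of "map dmir bs" "dmir w" "map dmir as"] assms(3,4)
      shell_mir[of l "(as, w, bs)"] by auto
  then have "f (as, w, bs) = f ([], dmir s, [dmir w'])"
    using inv_down0[OF inv, of "[]" 0 "dmir s" "dmir w'"] l by (simp add: o_def)
  then show ?thesis by blast
qed

lemma inv_const:
  assumes inv: "invariant l f" and l: "2 \<le> l" and len: "\<And>c d. f c = f d \<Longrightarrow> len c = len d"
    and square: "\<And>p q s. f ([p], Eps, [q, s]) = f ([], p, [Nd q s])"
    and "shell l c" "shell l d" "len c = len d"
  shows "f c = f d"
proof -
  let ?K = "\<lambda>w s. f ([], w, [s])"
  note l1 = l1[OF inv l]
  txt \<open>\<open>?K w s\<close> is the invariant on the chain of length two given by \<open>w\<close> and \<open>s\<close>. Such chains are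
    linked by passing through the upper levels (\<open>push\<close>) or the lower levels (\<open>turn\<close>) and then
    through an exchange.\<close>
  have push: "\<exists>w'. size w' = size w \<and> (\<forall>s. ?K w (Nd q s) = ?K (Nd w' q) s)" for w q
  proof -
    have "paths_down f 0" using paths[OF inv l, of 0] l by simp
    then obtain w' where w': "size w' = size w"
      "\<And>s bs. length bs = 2 * 0 \<Longrightarrow> f ([w], Eps, q # s # bs) = f ([], Nd w' q, s # bs)"
      unfolding paths_down_def by blast
    have "?K w (Nd q s) = ?K (Nd w' q) s" for s using w'(2)[of "[]" s] square[of w q s] by simp
    then show ?thesis using w'(1) by blast
  qed
  have turn: "\<exists>v'. size v' = size v \<and> (\<forall>w. ?K w (dsnoc u v) = ?K w (Nd (drot' u) v'))" for u v
  proof -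
    have "paths_up (\<lambda>c. f (mir c)) 0" using paths[OF inv_mir[OF inv] l, of 0] l by simp
    then obtain p where p: "size p = size (dmir v)"
      "\<And>s bs. length bs = 2 * 0 \<Longrightarrow>
        f (mir ([], Nd (dmir v) (dmir u), s # bs)) = f (mir ([p], Eps, dmir u # s # bs))"
      unfolding paths_up_def by blast
    have "?K w (dsnoc u v) = ?K w (Nd (drot' u) (dmir p))" for w
    proof -
      have "?K w (dsnoc u v) = f ([w], dsnoc u v, [])"
        using l by (intro inv_down0[OF inv l1, of _ 0]) auto
      also have "\<dots> = f ([u, w], Eps, [dmir p])" using p(2)[of "[]" "dmir w"] by simp
      also have "\<dots> = f ([w], Eps, [drot' u, dmir p])"
        using inv_X1[OF inv l1 l, of w "drot' u" "dmir p"] by simp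
      also have "\<dots> = ?K w (Nd (drot' u) (dmir p))" by (rule square)
      finally show ?thesis .
    qed
    then show ?thesis using p(1) by (intro exI[of _ "dmir p"]) auto
  qed
  have const: "?K w s = ?K w s'" if "size s = size s'" for w s s'
    using that
  proof (induction "size s" arbitrary: w s s' rule: less_induct)
    case less
    \<comment> \<open>The same \<open>w'\<close> serves \<open>c\<close> and \<open>c'\<close>, so
      the push can be undone after the induction hypothesis has been applied to the shorter second
      word.\<close>
    have inner: "?K w (Nd b c) = ?K w (Nd b c')" if "size c < size s" "size c = size c'" for w b c c'
    proof -
      obtain w' where "\<And>s. ?K w (Nd b s) = ?K (Nd w' b) s" using push[of w b] by blast
      then show ?thesis using less.hyps[OF that, of "Nd w' b"] by simp
    qed
    have last0: "\<exists>c'. size c' = size b \<and> ?K w (Nd b Eps) = ?K w (Nd Eps c')" for w b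
      using turn[of b Eps] by (metis drot'.simps(1) dsnoc.simps(1))
    \<comment> \<open>\<open>inner\<close> makes the word end in an empty bracket pair,
      \<open>turn\<close> puts the remainder into the first bracket with nothing behind it, and
      \<open>last0\<close> then empties that bracket.\<close>
    have norm: "\<exists>c'. Suc (size c') = size t \<and> ?K w t = ?K w (Nd Eps c')"
      if t: "size t = size s" "t = Nd b c" for t b c
    proof (cases c rule: dyck_dsnoc_cases)
      case 1
      obtain c' where "size c' = size b" "?K w (Nd b Eps) = ?K w (Nd Eps c')"
        using last0 by blast
      then show ?thesis using 1 t by (intro exI[of _ c']) auto
    next
      case (2 c1 c2)
      define c0 where "c0 = dapp c1 c2"
      have sz: "size (dsnoc c0 Eps) = size c" using 2 by (simp add: c0_def)
      have "?K w t = ?K w (Nd b (dsnoc c0 Eps))" unfolding t(2)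
        by (rule inner) (use t sz in simp_all)
      also have "\<dots> = ?K w (dsnoc (Nd b c0) Eps)" by simp
      finally have 1: "?K w t = ?K w (dsnoc (Nd b c0) Eps)" .
      have "\<exists>v'. size v' = size Eps \<and> ?K w (dsnoc (Nd b c0) Eps) = ?K w (Nd (drot' (Nd b c0)) v')"
        using turn[of Eps "Nd b c0"] by blast
      then have 2: "?K w t = ?K w (Nd (dsnoc b c0) Eps)" using 1 by auto
      obtain c' where "size c' = size (dsnoc b c0)" "?K w (Nd (dsnoc b c0) Eps) = ?K w (Nd Eps c')"
        using last0 by blast
      then show ?thesis using 2 sz t by (intro exI[of _ c']) auto
    qed
    show ?case
    proof (cases s)
      case Eps
      then show ?thesis using less.prems by simp
    next
      case (Nd b c)
      then obtain b' c' where s': "s' = Nd b' c'" using less.prems by (cases s') auto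
      obtain x where x: "Suc (size x) = size s" "?K w s = ?K w (Nd Eps x)"
        using norm[OF refl Nd] by blast
      obtain x' where x': "Suc (size x') = size s'" "?K w s' = ?K w (Nd Eps x')"
        using norm[OF less.prems[symmetric] s'] by blast
      have "?K w (Nd Eps x) = ?K w (Nd Eps x')" by (rule inner) (use x(1) x'(1) less.prems in simp_all)
      then show ?thesis unfolding x(2) x'(2) .
    qed
  qed
  \<comment> \<open>Pushes consume the second word factor by factor; once it is empty,
    \<open>X_link\<close> turns the first word into a second one.\<close>
  have left: "\<exists>s'. ?K w s = ?K Eps s'" for w s
  proof (induction s arbitrary: w)
    case Eps
    then show ?case using X_link[OF inv l] by (cases w) metis+
  next
    case (Nd q s)
    then show ?case using push[of w q] by metis
  qed
  have reach: "\<exists>s. f c = ?K Eps s" if "shell l c" for c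
  proof -
    obtain as w bs where c: "c = (as, w, bs)" by (cases c)
    have "length as \<noteq> length bs" using that c by (auto simp: shell_def window_def)
    then show ?thesis
      using upper_reaches[OF inv l, of as w bs] lower_reaches[OF inv l, of as w bs] left that c
      by (metis linorder_neqE_nat)
  qed
  obtain s s' where "f c = ?K Eps s" "f d = ?K Eps s'" using reach assms by metis
  moreover from this have "size s = size s'"
    using len[of c "([], Eps, [s])"] len[of d "([], Eps, [s'])"] assms by auto
  ultimately show ?thesis using const by metis
qed

section \<open>Hamilton cycles\<close>

definition confs :: "nat \<Rightarrow> nat \<Rightarrow> conf set" where
  "confs m l = {c. len c = 2 * m + 1 \<and> window l c}"

definition shells :: "nat \<Rightarrow> nat \<Rightarrow> conf set" where
  "shells m l = {c. len c = 2 * m + 1 \<and> shell l c}"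

lemma finite_len: "finite {c. len c = n}"
proof (rule finite_imageD)
  show "finite (word ` {c. len c = n})"
    by (rule finite_subset[OF image_subsetI finite_lists_length_eq[OF finite_UNIV, of n]]) simp
  show "inj_on word {c. len c = n}" using inj_word by (rule inj_on_subset) simp
qed

lemma finite_shells: "finite (shells m l)"
  by (rule finite_subset[OF _ finite_len]) (auto simp: shells_def)

lemma cadj_parity: "cadj c d \<Longrightarrow> even (weight (word d)) \<longleftrightarrow> odd (weight (word c))"
  unfolding cadj_def flip_def by (elim exE conjE, case_tac b) simp_all

lemma shell_cycles:
  obtains \<C> where "finite \<C>" "\<And>c. c \<in> \<C> \<Longrightarrow> cyc cadj c"
    "\<And>c d. c \<in> \<C> \<Longrightarrow> d \<in> \<C> \<Longrightarrow> c \<noteq> d \<Longrightarrow> set c \<inter> set d = {}" "(\<Union>c\<in>\<C>. set c) = shells m l"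
    "\<And>x. x \<in> shells m l \<Longrightarrow> {x, alpha l x} \<in> (\<Union>c\<in>\<C>. edges c)"
    "\<And>x. x \<in> shells m l \<Longrightarrow> {x, beta l x} \<in> (\<Union>c\<in>\<C>. edges c)"
proof (rule cycles_of_two_matchings[OF finite_shells[of m l], where R = cadj and \<alpha> = "alpha l" and
      \<beta> = "beta l" and Q = "\<lambda>c. even (weight (word c))"])
  show "cadj x y \<Longrightarrow> cadj y x" for x y by (rule cadj_sym)
  show "alpha l x \<in> shells m l \<and> alpha l (alpha l x) = x \<and> cadj x (alpha l x) \<and>
    (even (weight (word (alpha l x))) \<longleftrightarrow> \<not> even (weight (word x)))" if "x \<in> shells m l" for x
    using that matches_alpha[of l x] cadj_parity by (auto simp: shells_def matches_def)
  show "beta l x \<in> shells m l \<and> beta l (beta l x) = x \<and> cadj x (beta l x) \<and>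
    (even (weight (word (beta l x))) \<longleftrightarrow> \<not> even (weight (word x)))" if "x \<in> shells m l" for x
    using that matches_beta[of l x] cadj_parity by (auto simp: shells_def matches_def)
qed (rule that)

lemma same_cycle:
  assumes "{x, y} \<in> (\<Union>c\<in>\<C>. edges c)" "\<And>c. c \<in> \<C> \<Longrightarrow> cyc R c"
    and "\<And>c. c \<in> \<C> \<Longrightarrow> set c \<subseteq> S \<or> set c \<inter> S = {}"
  shows "x \<in> S \<longleftrightarrow> y \<in> S"
proof -
  obtain c where c: "c \<in> \<C>" "{x, y} \<in> edges c" using assms(1) by blast
  then have "{x, y} \<subseteq> set c" using edges_subset cyc_nonempty assms(2) by metis
  then show ?thesis using assms(3)[OF c(1)] by blast
qed

text \<open>This turns the closed sets in the connectivity hypothesis of \<open>glue_cycles\<close>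
  into invariants. Since \<open>S\<close> lives in a single length, membership is constant in all
  others.\<close>

lemma inv_of_closed:
  assumes "\<And>c. c \<in> \<C> \<Longrightarrow> cyc R c"
    and "\<And>c. c \<in> \<C> \<Longrightarrow> set c \<subseteq> S \<or> set c \<inter> S = {}"
    and "\<And>x. x \<in> shells m l \<Longrightarrow> {x, alpha l x} \<in> (\<Union>c\<in>\<C>. edges c)"
    and "\<And>x. x \<in> shells m l \<Longrightarrow> {x, beta l x} \<in> (\<Union>c\<in>\<C>. edges c)"
    and S: "S \<subseteq> {c. len c = 2 * m + 1}"
  shows "invariant l (\<lambda>c. (len c, c \<in> S))"
  unfolding invariant_def
proof (intro allI impI)
  fix c assume c: "shell l c"
  have a: "len (alpha l c) = len c" "len (beta l c) = len c"
    using matches_alpha[OF c] matches_beta[OF c] by (auto simp: matches_def)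
  show "(len (alpha l c), alpha l c \<in> S) = (len c, c \<in> S) \<and> (len (beta l c), beta l c \<in> S) = (len c, c \<in> S)"
  proof (cases "len c = 2 * m + 1")
    case True
    then have "c \<in> shells m l" using c by (simp add: shells_def)
    then show ?thesis using a same_cycle[OF assms(3) assms(1,2)] same_cycle[OF assms(4) assms(1,2)] by blast
  next
    case False
    then show ?thesis using S a by auto
  qed
qed

text \<open>The edges that are kept for attaching a block; no exchange removes them.\<close>

definition keyed :: "nat \<Rightarrow> conf list \<Rightarrow> bool" where
  "keyed m c \<longleftrightarrow> (\<forall>v. size v = m \<longrightarrow> {([], v, [Eps]), ([v], Eps, [])} \<in> edges c)"

definition ham :: "nat \<Rightarrow> nat \<Rightarrow> conf list \<Rightarrow> bool" where
  "ham m l c \<longleftrightarrow> cyc cadj c \<and> set c = confs m l \<and> keyed m c"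

section \<open>Exchanges along 6-cycles\<close>

text \<open>The 6-cycle consists of the words 1 i j u k v 0 with i j k in the two middle levels of
  the 3-cube. \<open>P\<close> is the stretch of the 2-factor from x = 110u0v0 to z = 100u1v0,
  written out because \<open>merges_hexagon\<close> must know it; the edge from y = 101u0v0 to y' =
  111u0v0 belongs to the second matching.\<close>

definition hexagon :: "dyck \<Rightarrow> dyck \<Rightarrow> conf toggle" where
  "hexagon u v = (let
      x = ([Nd (Nd Eps u) v], Eps, []);
      P = [([], Eps, [dsnoc (Nd Eps u) v]), ([Eps], Nd Eps (dsnoc u v), []), ([Eps], Eps, [Eps, dsnoc u v]),
           ([Eps, Eps], Eps, [dsnoc u v]), ([], Nd Eps Eps, [dsnoc u v])];
      z = ([Nd Eps Eps], dsnoc u v, []);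
      y = ([Nd Eps (Nd u v)], Eps, []);
      y' = ([], Eps, [dsnoc Eps (Nd u v)])
    in \<lparr>end1 = x, end2 = y, used = insert {y, y'} (pedges (x # P @ [z])),
        removed = {{x, hd P}, {last P, z}, {y, y'}}\<rparr>)"

lemma merges_hexagon_conf: "merges cadj (hexagon u v)"
proof -
  define x :: conf where "x = ([Nd (Nd Eps u) v], Eps, [])"
  define P :: "conf list" where "P = [([], Eps, [dsnoc (Nd Eps u) v]), ([Eps], Nd Eps (dsnoc u v), []), ([Eps], Eps, [Eps, dsnoc u v]),
           ([Eps, Eps], Eps, [dsnoc u v]), ([], Nd Eps Eps, [dsnoc u v])]"
  define z :: conf where "z = ([Nd Eps Eps], dsnoc u v, [])"
  define y :: conf where "y = ([Nd Eps (Nd u v)], Eps, [])"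
  define y' :: conf where "y' = ([], Eps, [dsnoc Eps (Nd u v)])"
  have h: "hexagon u v = \<lparr>end1 = x, end2 = y, used = insert {y, y'} (pedges (x # P @ [z])),
        removed = {{x, hd P}, {last P, z}, {y, y'}}\<rparr>"
    by (simp add: hexagon_def x_def P_def z_def y_def y'_def Let_def)
  show ?thesis
  proof (rule merges_hexagon)
    show "cadj c d \<Longrightarrow> cadj d c" for c d by (rule cadj_sym)
    show "cadj z (hd P)" "cadj (last P) y" "cadj x y'"
      by (auto simp: x_def P_def z_def y_def y'_def cadj_def intro!: flip_intros)
    show "distinct (x # P @ [z])" "P \<noteq> []" by (auto simp: x_def P_def z_def)
  qed (auto simp: h)
qed

lemma hexagon_ends: "end1 (hexagon u v) = ([Nd (Nd Eps u) v], Eps, [])"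
  "end2 (hexagon u v) = ([Nd Eps (Nd u v)], Eps, [])"
  by (simp_all add: hexagon_def Let_def)

text \<open>The removed edges determine u and v and differ in shape: the first subtree of the tree
  is nonempty in \<open>x\<close> and empty in \<open>y\<close>, and the third edge is a chain
  edge.\<close>

lemma hexagon_independent:
  assumes "e \<in> used (hexagon u v)" "e \<in> removed (hexagon u' v')"
  shows "u = u' \<and> v = v'"
  using assms by (simp add: hexagon_def Let_def) (elim disjE; simp add: doubleton_eq_iff)

lemma alpha_key: "alpha l ([], v, [Eps]) = ([v], Eps, [])"
  by (simp add: sym_ext_def upper_def)

lemma ham_1: "\<exists>c. ham m 1 c"
proof -
  let ?V = "shells m 1"
  obtain \<C> where \<C>: "finite \<C>" "\<And>c. c \<in> \<C> \<Longrightarrow> cyc cadj c"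
    "\<And>c d. c \<in> \<C> \<Longrightarrow> d \<in> \<C> \<Longrightarrow> c \<noteq> d \<Longrightarrow> set c \<inter> set d = {}" "(\<Union>c\<in>\<C>. set c) = ?V"
    "\<And>x. x \<in> ?V \<Longrightarrow> {x, alpha 1 x} \<in> (\<Union>c\<in>\<C>. edges c)"
    "\<And>x. x \<in> ?V \<Longrightarrow> {x, beta 1 x} \<in> (\<Union>c\<in>\<C>. edges c)"
    by (rule shell_cycles[of m 1]) (rule that)
  define \<T> where "\<T> = {hexagon u v | u v. size u + size v + 2 = m}"
  have shell: "c \<in> ?V \<longleftrightarrow> c \<in> confs m 1" for c
    by (cases c) (auto simp: shells_def confs_def shell_def block_def)
  have key: "{([], v, [Eps]), ([v], Eps, [])} \<in> (\<Union>c\<in>\<C>. edges c)" if "size v = m" for v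
  proof -
    have "([], v, [Eps]) \<in> ?V" using that unfolding shell by (simp add: confs_def window_def)
    from \<C>(5)[OF this] show ?thesis unfolding alpha_key .
  qed
  have "\<exists>c. cyc cadj c \<and> set c = ?V \<and> (\<Union>c\<in>\<C>. edges c) - (\<Union>t\<in>\<T>. removed t) \<subseteq> edges c"
  proof (rule glue_cycles[OF \<C>(1) _ \<C>(2,3,4)])
    obtain v :: dyck where v: "size v = m"
    proof -
      have "\<exists>v :: dyck. size v = m"
      proof (induction m)
        case (Suc m)
        then obtain v :: dyck where "size v = m" by blast
        then show ?case by (intro exI[of _ "Nd Eps v"]) simp
      qed (intro exI[of _ Eps], simp)
      then show thesis using that by blast
    qed
    show "\<C> \<noteq> {}" using key[OF v] by blast
    show "merges cadj t" if "t \<in> \<T>" for t using that merges_hexagon_conf by (auto simp: \<T>_def)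
    show "end1 t \<in> ?V \<and> end2 t \<in> ?V" if "t \<in> \<T>" for t
      using that by (auto simp: \<T>_def hexagon_ends shell confs_def window_def simp del: One_nat_def)
    show "used t \<subseteq> (\<Union>c\<in>\<C>. edges c)" if tT: "t \<in> \<T>" for t
    proof -
      obtain u v where t: "t = hexagon u v" "size u + size v + 2 = m" using tT by (auto simp: \<T>_def)
      have V: "([], Eps, [dsnoc (Nd Eps u) v]) \<in> ?V" "([Eps], Eps, [Eps, dsnoc u v]) \<in> ?V"
        "([], Nd Eps Eps, [dsnoc u v]) \<in> ?V" "([], Eps, [dsnoc Eps (Nd u v)]) \<in> ?V"
        using t by (auto simp: shell confs_def window_def simp del: One_nat_def)
      have "dright (Nd Eps Eps) = Eps" "dleft (Nd Eps Eps) = Eps"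
        using dright_dsnoc[of Eps Eps] dleft_dsnoc[of Eps Eps] by simp_all
      moreover have "drot (Nd Eps (dsnoc u v)) = Nd (Nd Eps u) v" "drot (Nd (Nd u v) Eps) = Nd Eps (Nd u v)"
        using drot_simps(2)[of "Nd Eps u" v] drot_simps(2)[of Eps "Nd u v"] by simp_all
      ultimately show ?thesis unfolding t(1)
        using \<C>(5)[OF V(1)] \<C>(6)[OF V(1)] \<C>(5)[OF V(2)] \<C>(6)[OF V(2)] \<C>(5)[OF V(3)] \<C>(6)[OF V(3)] \<C>(6)[OF V(4)]
        by (auto simp: hexagon_def Let_def sym_ext_def upper_def insert_commute simp del: UN_iff)
    qed
    show "used t \<inter> removed t' = {}" if "t \<in> \<T>" "t' \<in> \<T>" "t \<noteq> t'" for t t'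
      using that hexagon_independent unfolding \<T>_def by blast
    show "S = ?V" if S: "S \<subseteq> ?V" "S \<noteq> {}" "\<And>c. c \<in> \<C> \<Longrightarrow> set c \<subseteq> S \<or> set c \<inter> S = {}"
      "\<And>t. t \<in> \<T> \<Longrightarrow> end1 t \<in> S \<longleftrightarrow> end2 t \<in> S" for S
    proof -
      let ?f = "\<lambda>c. (len c, c \<in> S)"
      have lenS: "S \<subseteq> {c. len c = 2 * m + 1}" using S(1) by (auto simp: shells_def)
      have inv: "invariant 1 ?f" by (rule inv_of_closed[OF \<C>(2) S(3) \<C>(5,6) lenS])
      have hex: "?f ([Nd (Nd Eps u) v], Eps, []) = ?f ([Nd Eps (Nd u v)], Eps, [])" for u v
      proof (cases "size u + size v + 2 = m")
        case True
        then show ?thesis using S(4)[of "hexagon u v"] by (auto simp: \<T>_def hexagon_ends)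
      next
        case False
        then show ?thesis using lenS by auto
      qed
      have const: "?f c = ?f d" if "shell 1 c" "shell 1 d" "len c = len d" for c d
        by (rule inv_1_const[OF inv _ hex that]) simp
      obtain d where d: "d \<in> S" using S(2) by blast
      have "c \<in> S" if "c \<in> ?V" for c
        using const[of c d] d subsetD[OF S(1) d] that by (simp add: shells_def)
      then show ?thesis using S(1) by blast
    qed
  qed
  then obtain c where c: "cyc cadj c" "set c = ?V"
    "(\<Union>c\<in>\<C>. edges c) - (\<Union>t\<in>\<T>. removed t) \<subseteq> edges c" by blast
  have "{([], v, [Eps]), ([v], Eps, [])} \<notin> (\<Union>t\<in>\<T>. removed t)" for v
    by (auto simp: \<T>_def hexagon_def Let_def doubleton_eq_iff)
  then have "keyed m c" unfolding keyed_def using key c(3) by blast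
  then show ?thesis using c shell unfolding ham_def by blast
qed

section \<open>Blocks as copies of smaller windows\<close>

fun emb :: "dyck \<times> dyck \<times> dyck \<times> dyck \<Rightarrow> conf \<Rightarrow> conf" where
  "emb (a, b, c, d) (as, w, bs) = (as @ [b, a], w, bs @ [c, d])"

fun size4 :: "dyck \<times> dyck \<times> dyck \<times> dyck \<Rightarrow> nat" where
  "size4 (a, b, c, d) = size a + size b + size c + size d"

lemma emb_eq_iff [simp]: "emb k x = emb k' x' \<longleftrightarrow> k = k' \<and> x = x'"
  by (cases k; cases k'; cases x; cases x') auto

lemma len_emb [simp]: "len (emb k x) = len x + 2 * size4 k + 4"
  by (cases k; cases x) auto

lemma cadj_emb: "cadj x y \<Longrightarrow> cadj (emb k x) (emb k y)"
proof (cases k; cases x; cases y)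
  fix a b c d as w bs as' w' bs'
  assume eq: "k = (a, b, c, d)" "x = (as, w, bs)" "y = (as', w', bs')" and "cadj x y"
  then have "flip (word x) (word y)" by (simp add: cadj_def)
  from flip_append[OF this, of "dword a @ False # dword b @ [False]" "True # dword c @ True # dword d"]
  show "cadj (emb k x) (emb k y)" using eq by (simp add: cadj_def word0_append word1_append)
qed

lemma block_emb:
  assumes "2 \<le> l"
  shows "window l (emb k x) \<and> block l (emb k x) \<longleftrightarrow> window (l - 2) x"
  using assms by (cases k; cases x) (auto simp: window_def block_def)

lemma block_imp_emb:
  assumes "block l x"
  obtains k y where "x = emb k y"
proof -
  obtain as w bs where x: "x = (as, w, bs)" by (cases x)
  then have "2 \<le> length as" "2 \<le> length bs" using assms by (auto simp: block_def)
  then obtain as' a b bs' c d where "as = as' @ [b, a]" "rev bs = d # c # bs'"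
    by (cases as rule: rev_cases; cases "butlast as" rule: rev_cases; cases "rev bs" rule: dyck_list_cases) auto
  moreover from this have "bs = rev bs' @ [c, d]" by (simp add: rev_eq_Cons_iff)
  ultimately have "x = emb (a, b, c, d) (as', w, rev bs')" using x by simp
  then show ?thesis by (rule that)
qed

lemma pedges_map: "pedges (map g c) = (`) g ` pedges c"
  by (induction c rule: pedges.induct) auto

lemma edges_map: "c \<noteq> [] \<Longrightarrow> edges (map g c) = (`) g ` edges c"
  by (auto simp: edges_def pedges_map last_map hd_map)

lemma edges_doubleton: "e \<in> edges c \<Longrightarrow> \<exists>p q. e = {p, q}"
  unfolding edges_def using pedges_split[of e c] by blast

lemma cyc_emb:
  assumes "cyc cadj c"
  shows "cyc cadj (map (emb k) c)"
proof -
  have "inj (emb k)" by (rule injI) simp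
  then have "distinct (map (emb k) c)" using assms by (auto simp: cyc_def distinct_map inj_on_def)
  moreover have "cadj x y" if xy: "{x, y} \<in> edges (map (emb k) c)" for x y
  proof -
    obtain e where e: "e \<in> edges c" "{x, y} = emb k ` e"
      using xy edges_map[OF cyc_nonempty[OF assms], of "emb k"] by blast
    have "x \<in> emb k ` e" "y \<in> emb k ` e" using e(2) by blast+
    then obtain u v where uv: "u \<in> e" "v \<in> e" "x = emb k u" "y = emb k v" by blast
    obtain p q where pq: "e = {p, q}" using edges_doubleton[OF e(1)] by blast
    then have "cadj p q" using e(1) assms unfolding cyc_def by blast
    have "emb k p \<in> {x, y}" "emb k q \<in> {x, y}" using e(2) pq by auto
    then have "x = emb k p \<and> y = emb k q \<or> x = emb k q \<and> y = emb k p"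
      using e(2) pq by (auto simp: doubleton_eq_iff)
    then show ?thesis using \<open>cadj p q\<close> cadj_emb cadj_sym by blast
  qed
  ultimately show ?thesis using assms by (simp add: cyc_def)
qed

section \<open>Exchanges along 4-cycles\<close>

text \<open>Merely a Dyck word of each size; one exchange per block suffices, and any choice of v
  serves.\<close>

fun comb :: "nat \<Rightarrow> dyck" where
  "comb 0 = Eps"
| "comb (Suc n) = Nd Eps (comb n)"

lemma size_comb [simp]: "size (comb n) = n"
  by (induction n) auto

definition square :: "conf \<Rightarrow> conf \<Rightarrow> conf \<Rightarrow> conf \<Rightarrow> conf toggle" where
  "square x y x' y' = \<lparr>end1 = x, end2 = x', used = {{x, y}, {x', y'}}, removed = {{x, y}, {x', y'}}\<rparr>"

lemma square_sel [simp]: "end1 (square x y x' y') = x" "end2 (square x y x' y') = x'"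
  "used (square x y x' y') = {{x, y}, {x', y'}}" "removed (square x y x' y') = {{x, y}, {x', y'}}"
  by (simp_all add: square_def)

lemma merges_square_conf: "cadj x x' \<Longrightarrow> cadj y y' \<Longrightarrow> merges cadj (square x y x' y')"
  by (rule merges_square[of cadj x x' y y']) (auto intro: cadj_sym)

text \<open>The words p i 1 q j s with bits i and j. Flipping i is a chain edge for either j, so the
  square joins the top of a chain with four vertices to a chain with two.\<close>

definition shell_square :: "dyck \<times> dyck \<times> dyck \<Rightarrow> conf toggle" where
  "shell_square k = (case k of (p, q, s) \<Rightarrow>
    square ([p], Eps, [q, s]) ([], p, [Eps, q, s]) ([p], Nd q s, []) ([], p, [Nd q s]))"

text \<open>The words a 0 b 0 v i 1 c j d. For j = 1 flipping i gives the kept edge of the block;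
  for j = 0 it gives a chain edge of the shell, as at most one unmatched 1 is left.\<close>

definition block_square :: "nat \<Rightarrow> dyck \<times> dyck \<times> dyck \<times> dyck \<Rightarrow> conf toggle" where
  "block_square m k = (case k of (a, b, c, d) \<Rightarrow> let v = comb (m - 2 - size4 k) in
    square ([b, a], v, [Eps, c, d]) ([v, b, a], Eps, [c, d]) ([b, a], v, [Nd c d]) ([v, b, a], Nd c d, []))"

lemma merges_shell_square: "merges cadj (shell_square k)"
  unfolding shell_square_def
  by (cases k) (auto intro!: merges_square_conf flip_intros simp: cadj_def)

lemma merges_block_square: "merges cadj (block_square m k)"
  unfolding block_square_def
  by (cases k) (auto intro!: merges_square_conf flip_intros simp: cadj_def Let_def)

lemma shell_square_independent:
  assumes "e \<in> used (shell_square k)" "e \<in> removed (shell_square k')"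
  shows "k = k'"
proof -
  obtain p q s p' q' s' where k: "k = (p, q, s)" "k' = (p', q', s')" by (cases k; cases k')
  show ?thesis using assms unfolding k shell_square_def
    by (simp add: k) (elim disjE; simp add: doubleton_eq_iff)
qed

lemma block_square_independent:
  assumes "e \<in> used (block_square m k)" "e \<in> removed (block_square m k')"
  shows "k = k'"
proof -
  obtain a b c d a' b' c' d' where k: "k = (a, b, c, d)" "k' = (a', b', c', d')" by (cases k; cases k')
  show ?thesis using assms unfolding k block_square_def
    by (simp add: k Let_def) (elim disjE; simp add: doubleton_eq_iff)
qed

lemma shell_block_independent:
  "used (shell_square k) \<inter> removed (block_square m k') = {}"
  "used (block_square m k') \<inter> removed (shell_square k) = {}"
proof -
  obtain p q s a b c d where k: "k = (p, q, s)" "k' = (a, b, c, d)" by (cases k; cases k')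
  show "used (shell_square k) \<inter> removed (block_square m k') = {}"
    "used (block_square m k') \<inter> removed (shell_square k) = {}"
    unfolding k shell_square_def block_square_def by (simp_all add: Let_def doubleton_eq_iff)
qed

lemma finite_size4: "finite {k. size4 k \<le> n}"
proof (rule finite_subset)
  let ?g = "\<lambda>(a, b, c, d). ([b, a], Eps, [c, d])"
  have "inj ?g" by (rule injI) auto
  then show "finite (?g -` (\<Union>i\<le>2 * n + 4. {c. len c = i}))"
    by (intro finite_vimageI) (auto simp: finite_len)
  show "{k. size4 k \<le> n} \<subseteq> ?g -` (\<Union>i\<le>2 * n + 4. {c. len c = i})" by auto
qed

lemma ham_step:
  assumes l: "2 \<le> l" and IH: "\<And>m. 3 \<le> l \<Longrightarrow> ham m (l - 2) (H m)"
  shows "\<exists>c. ham m l c"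
proof -
  let ?V = "shells m l"
  obtain \<C> where \<C>: "finite \<C>" "\<And>c. c \<in> \<C> \<Longrightarrow> cyc cadj c"
    "\<And>c d. c \<in> \<C> \<Longrightarrow> d \<in> \<C> \<Longrightarrow> c \<noteq> d \<Longrightarrow> set c \<inter> set d = {}" "(\<Union>c\<in>\<C>. set c) = ?V"
    "\<And>x. x \<in> ?V \<Longrightarrow> {x, alpha l x} \<in> (\<Union>c\<in>\<C>. edges c)"
    "\<And>x. x \<in> ?V \<Longrightarrow> {x, beta l x} \<in> (\<Union>c\<in>\<C>. edges c)"
    by (rule shell_cycles[of m l]) (rule that)
  \<comment> \<open>For \<open>l = 2\<close> the inner window is empty and there are no blocks.
    Otherwise block k has dimension \<open>2 * (m - 2 - size4 k) + 1\<close>, the subtraction being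
    exact by the second condition.\<close>
  define K where "K = {k. 3 \<le> l \<and> size4 k + 2 \<le> m}"
  define B where "B k = map (emb k) (H (m - 2 - size4 k))" for k
  define \<D> where "\<D> = \<C> \<union> B ` K"
  define \<T> where "\<T> = shell_square ` {(p, q, s). size p + size q + size s + 1 = m} \<union> block_square m ` K"
  have H: "cyc cadj (H m)" "set (H m) = confs m (l - 2)" "keyed m (H m)" if "3 \<le> l" for m
    using IH[OF that, of m] by (auto simp: ham_def)
  have V: "c \<in> ?V \<longleftrightarrow> c \<in> confs m l \<and> \<not> block l c" for c
    by (auto simp: shells_def confs_def shell_def)
  have setB: "set (B k) = emb k ` confs (m - 2 - size4 k) (l - 2)" if "k \<in> K" for k
    using that H by (simp add: B_def K_def)
  have B_block: "x \<in> confs m l \<and> block l x" if k: "k \<in> K" "x \<in> set (B k)" for k x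
  proof -
    obtain y where y: "x = emb k y" "y \<in> confs (m - 2 - size4 k) (l - 2)" using k setB by blast
    then show ?thesis using k block_emb[OF l, of k y] by (auto simp: K_def confs_def)
  qed
  have block_B: "\<exists>k\<in>K. x \<in> set (B k)" if x: "x \<in> confs m l" "block l x" for x
  proof -
    obtain k y where y: "x = emb k y" using block_imp_emb[OF x(2)] by blast
    then have w: "window (l - 2) y" using block_emb[OF l, of k y] x by (simp add: confs_def)
    have "len y + 2 * size4 k + 4 = 2 * m + 1"
      using x y by (simp add: confs_def)
    moreover from this have "odd (len y)" by presburger
    ultimately have "1 \<le> len y" using odd_pos by (metis One_nat_def Suc_leI)
    then have sz: "size4 k + 2 \<le> m" "len y = 2 * (m - 2 - size4 k) + 1"
      using \<open>len y + 2 * size4 k + 4 = 2 * m + 1\<close> by auto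
    have "3 \<le> l" using w by (cases y) (auto simp: window_def)
    then have "k \<in> K" using sz by (simp add: K_def)
    moreover have "x \<in> set (B k)" using setB[OF \<open>k \<in> K\<close>] y w sz by (simp add: confs_def)
    ultimately show ?thesis by blast
  qed
  have B_ne: "B k \<noteq> []" if "k \<in> K" for k
    using that H(1) cyc_nonempty by (auto simp: B_def K_def)
  have edge_V: "{x, y} \<in> (\<Union>c\<in>\<D>. edges c)" if "x \<in> ?V" "alpha l x = y" for x y
    using \<C>(5)[OF that(1)] that(2) unfolding \<D>_def by blast
  have key: "{([], v, [Eps]), ([v], Eps, [])} \<in> (\<Union>c\<in>\<D>. edges c)" if "size v = m" for v
  proof (rule edge_V)
    show "([], v, [Eps]) \<in> ?V" using that l by (auto simp: shells_def shell_def window_def block_def)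
  qed (rule alpha_key)
  have D_cyc: "cyc cadj c" if "c \<in> \<D>" for c
    using that \<C>(2) cyc_emb H(1) unfolding \<D>_def B_def K_def by auto
  have block_edge: "{emb k ([], comb (m - 2 - size4 k), [Eps]), emb k ([comb (m - 2 - size4 k)], Eps, [])}
      \<in> edges (B k)" if k: "k \<in> K" for k
  proof -
    let ?v = "comb (m - 2 - size4 k)"
    have h: "3 \<le> l" using k by (simp add: K_def)
    have "{([], ?v, [Eps]), ([?v], Eps, [])} \<in> edges (H (m - 2 - size4 k))"
      using H(3)[OF h] unfolding keyed_def by simp
    then have "emb k ` {([], ?v, [Eps]), ([?v], Eps, [])} \<in> edges (B k)"
      unfolding B_def using edges_map[OF cyc_nonempty[OF H(1)[OF h]]] by blast
    then show ?thesis by simp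
  qed
  have "\<exists>c. cyc cadj c \<and> set c = confs m l \<and> (\<Union>c\<in>\<D>. edges c) - (\<Union>t\<in>\<T>. removed t) \<subseteq> edges c"
  proof (rule glue_cycles[where \<C> = \<D> and \<T> = \<T>])
    have "K \<subseteq> {k. size4 k \<le> m}" by (auto simp: K_def)
    then show "finite \<D>" unfolding \<D>_def using \<C>(1) finite_subset[OF _ finite_size4] by blast
    show "\<D> \<noteq> {}" using key[of "comb m"] by auto
    show "cyc cadj c" if "c \<in> \<D>" for c using that by (rule D_cyc)
    show "set c \<inter> set d = {}" if cd: "c \<in> \<D>" "d \<in> \<D>" "c \<noteq> d" for c d
    proof -
      have CB: "set c \<inter> set (B k) = {}" if "c \<in> \<C>" "k \<in> K" for c k
      proof -
        have "set c \<subseteq> ?V" using \<C>(4) that by blast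
        then show ?thesis using B_block[OF that(2)] V by blast
      qed
      have BB: "set (B k) \<inter> set (B k') = {}" if "k \<in> K" "k' \<in> K" "k \<noteq> k'" for k k'
        using that by (auto simp: setB)
      consider "c \<in> \<C>" "d \<in> \<C>" | k where "c \<in> \<C>" "k \<in> K" "d = B k" | k where "d \<in> \<C>" "k \<in> K" "c = B k"
        | k k' where "k \<in> K" "k' \<in> K" "c = B k" "d = B k'"
        using cd(1,2) unfolding \<D>_def by blast
      then show ?thesis
      proof cases
        case 1
        then show ?thesis using \<C>(3) cd(3) by blast
      next
        case 2
        then show ?thesis using CB by blast
      next
        case 3
        then show ?thesis using CB by blast
      next
        case 4
        then show ?thesis using BB[of k k'] cd(3) by blast
      qed
    qed
    show "(\<Union>c\<in>\<D>. set c) = confs m l"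
    proof
      show "(\<Union>c\<in>\<D>. set c) \<subseteq> confs m l"
        using \<C>(4) V B_block unfolding \<D>_def by blast
      show "confs m l \<subseteq> (\<Union>c\<in>\<D>. set c)"
      proof
        fix x assume x: "x \<in> confs m l"
        show "x \<in> (\<Union>c\<in>\<D>. set c)"
        proof (cases "block l x")
          case True
          then show ?thesis using block_B[OF x] unfolding \<D>_def by blast
        next
          case False
          then have "x \<in> (\<Union>c\<in>\<C>. set c)" using x V \<C>(4) by simp
          then show ?thesis unfolding \<D>_def by blast
        qed
      qed
    qed
    show "merges cadj t" if "t \<in> \<T>" for t
      using that merges_shell_square merges_block_square unfolding \<T>_def by blast
    show "end1 t \<in> confs m l \<and> end2 t \<in> confs m l" if tT: "t \<in> \<T>" for t
      using tT l unfolding \<T>_def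
      by (auto simp: K_def shell_square_def block_square_def Let_def confs_def window_def)
    show "used t \<subseteq> (\<Union>c\<in>\<D>. edges c)" if tT: "t \<in> \<T>" for t
    proof -
      consider p q s where "size p + size q + size s + 1 = m" "t = shell_square (p, q, s)"
        | a b c d where "(a, b, c, d) \<in> K" "t = block_square m (a, b, c, d)"
        using tT unfolding \<T>_def by auto
      then show ?thesis
      proof cases
        case 1
        have "{([], p, [Eps, q, s]), ([p], Eps, [q, s])} \<in> (\<Union>c\<in>\<D>. edges c)"
          using 1 l by (intro edge_V) (auto simp: shells_def shell_def window_def block_def sym_ext_def upper_def)
        moreover have "{([], p, [Nd q s]), ([p], Nd q s, [])} \<in> (\<Union>c\<in>\<D>. edges c)"
          using 1 l by (intro edge_V) (auto simp: shells_def shell_def window_def block_def sym_ext_def upper_def)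
        ultimately show ?thesis unfolding 1(2) shell_square_def by (simp add: insert_commute)
      next
        case 2
        let ?v = "comb (m - 2 - size4 (a, b, c, d))"
        have h: "3 \<le> l" "size4 (a, b, c, d) + 2 \<le> m" using 2 by (auto simp: K_def)
        have "{([b, a], ?v, [Nd c d]), ([?v, b, a], Nd c d, [])} \<in> (\<Union>c\<in>\<D>. edges c)"
          using h l by (intro edge_V)
            (auto simp: shells_def shell_def window_def block_def sym_ext_def upper_def)
        moreover have "{([b, a], ?v, [Eps, c, d]), ([?v, b, a], Eps, [c, d])} \<in> (\<Union>c\<in>\<D>. edges c)"
          using block_edge[OF 2(1)] 2(1) unfolding \<D>_def by auto
        ultimately show ?thesis unfolding 2(2) block_square_def by (simp add: Let_def)
      qed
    qed
    show "used t \<inter> removed t' = {}" if tt: "t \<in> \<T>" "t' \<in> \<T>" "t \<noteq> t'" for t t'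
    proof -
      consider k k' where "t = shell_square k" "t' = shell_square k'"
        | k k' where "t = shell_square k" "t' = block_square m k'"
        | k k' where "t = block_square m k" "t' = shell_square k'"
        | k k' where "t = block_square m k" "t' = block_square m k'"
        using tt(1,2) unfolding \<T>_def by blast
      then show ?thesis
      proof cases
        case 1
        then show ?thesis using shell_square_independent[of _ k k'] tt(3) by blast
      next
        case 2
        then show ?thesis using shell_block_independent(1) by simp
      next
        case 3
        then show ?thesis using shell_block_independent(2) by simp
      next
        case 4
        then show ?thesis using block_square_independent[of _ m k k'] tt(3) by blast
      qed
    qed
    show "S = confs m l" if S: "S \<subseteq> confs m l" "S \<noteq> {}" "\<And>c. c \<in> \<D> \<Longrightarrow> set c \<subseteq> S \<or> set c \<inter> S = {}"
      "\<And>t. t \<in> \<T> \<Longrightarrow> end1 t \<in> S \<longleftrightarrow> end2 t \<in> S" for S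
    proof -
      let ?f = "\<lambda>c. (len c, c \<in> S)"
      have lenS: "S \<subseteq> {c. len c = 2 * m + 1}" using S(1) by (auto simp: confs_def)
      have \<C>S: "set c \<subseteq> S \<or> set c \<inter> S = {}" if "c \<in> \<C>" for c using S(3) that unfolding \<D>_def by blast
      have inv: "invariant l ?f" by (rule inv_of_closed[OF \<C>(2) \<C>S \<C>(5,6) lenS])
      have square: "?f ([p], Eps, [q, s]) = ?f ([], p, [Nd q s])" for p q s
      proof -
        have "?f ([], p, [Nd q s]) = ?f ([p], Nd q s, [])"
          using inv_down0[OF inv, of "[]" 0 p "Nd q s"] l by simp
        moreover have "?f ([p], Eps, [q, s]) = ?f ([p], Nd q s, [])"
        proof (cases "size p + size q + size s + 1 = m")
          case True
          then have "shell_square (p, q, s) \<in> \<T>" unfolding \<T>_def by blast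
          from S(4)[OF this] show ?thesis by (simp add: shell_square_def)
        next
          case False
          then show ?thesis using lenS by auto
        qed
        ultimately show ?thesis by simp
      qed
      have const: "?f c = ?f d" if "shell l c" "shell l d" "len c = len d" for c d
        by (rule inv_const[OF inv l _ square that]) simp
      \<comment> \<open>The cycle of a block contains an end of the exchange of that block, whose
        other end lies in the shell; so membership in \<open>S\<close> is decided on the
        shell.\<close>
      have exit: "\<exists>y\<in>?V. x \<in> S \<longleftrightarrow> y \<in> S" if x: "x \<in> confs m l" for x
      proof (cases "block l x")
        case False
        then show ?thesis using x V by blast
      next
        case True
        then obtain k where k: "k \<in> K" "x \<in> set (B k)" using block_B[OF x] by blast
        obtain a b c d where abcd: "k = (a, b, c, d)" by (cases k)
        let ?v = "comb (m - 2 - size4 k)"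
        let ?x = "([b, a], ?v, [Eps, c, d])" and ?y = "([b, a], ?v, [Nd c d])"
        have "{?x, ([?v, b, a], Eps, [c, d])} \<in> edges (B k)"
          using block_edge[OF k(1)] by (simp add: abcd)
        then have "?x \<in> set (B k)" using edges_subset[OF _ B_ne[OF k(1)]] by blast
        then have "x \<in> S \<longleftrightarrow> ?x \<in> S" using S(3)[of "B k"] k unfolding \<D>_def by blast
        also have "\<dots> \<longleftrightarrow> ?y \<in> S"
        proof -
          have "block_square m k \<in> \<T>" using k unfolding \<T>_def by blast
          from S(4)[OF this] show ?thesis unfolding abcd by (simp add: block_square_def Let_def)
        qed
        finally have "x \<in> S \<longleftrightarrow> ?y \<in> S" .
        moreover have "?y \<in> ?V"
          using k l by (auto simp: abcd K_def shells_def shell_def window_def block_def)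
        ultimately show ?thesis by blast
      qed
      obtain x where x: "x \<in> S" using S(2) by blast
      obtain y where y: "y \<in> ?V" "y \<in> S" using exit[of x] x S(1) by blast
      have "c \<in> S" if c: "c \<in> confs m l" for c
      proof -
        obtain z where z: "z \<in> ?V" "c \<in> S \<longleftrightarrow> z \<in> S" using exit[OF c] by blast
        then show ?thesis using const[of z y] y by (simp add: shells_def)
      qed
      then show ?thesis using S(1) by blast
    qed
  qed
  then obtain c where c: "cyc cadj c" "set c = confs m l"
    "(\<Union>c\<in>\<D>. edges c) - (\<Union>t\<in>\<T>. removed t) \<subseteq> edges c" by blast
  have "{([], v, [Eps]), ([v], Eps, [])} \<notin> (\<Union>t\<in>\<T>. removed t)" for v
    by (auto simp: \<T>_def shell_square_def block_square_def Let_def doubleton_eq_iff)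
  then have "keyed m c" unfolding keyed_def using key c(3) by blast
  then show ?thesis using c unfolding ham_def by blast
qed

lemma ham_exists: "1 \<le> l \<Longrightarrow> \<exists>c. ham m l c"
proof (induction l arbitrary: m rule: less_induct)
  case (less l)
  show ?case
  proof (cases "l = 1")
    case True
    then show ?thesis using ham_1 by simp
  next
    case False
    then have l: "2 \<le> l" using less.prems by simp
    have "\<forall>m. \<exists>c. 3 \<le> l \<longrightarrow> ham m (l - 2) c" using less.IH[of "l - 2"] by auto
    then obtain H where "\<forall>m. 3 \<le> l \<longrightarrow> ham m (l - 2) (H m)" by metis
    then show ?thesis using ham_step[OF l, of H] by blast
  qed
qed

section \<open>Return to the hypercube\<close>

text \<open>\<open>length bs - length as\<close> is twice the weight minus \<open>2 * m + 1\<close>,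
  which turns the bounds of \<open>window\<close> into bounds on the weight.\<close>

lemma word_confs:
  assumes "l \<le> m + 1"
  shows "word ` confs m l = (\<Union>k \<in> {m + 1 - l .. m + l}. level (2 * m + 1) k)"
proof -
  have "x \<in> confs m l \<longleftrightarrow> word x \<in> (\<Union>k \<in> {m + 1 - l .. m + l}. level (2 * m + 1) k)" for x
  proof -
    obtain as w bs where x: "x = (as, w, bs)" by (cases x)
    define N where "N = size_ds as + size w + size_ds bs"
    have len: "len x = 2 * N + length as + length bs" by (simp add: x N_def)
    have weight: "weight (word x) = N + length bs" unfolding x weight_word N_def ..
    show ?thesis
    proof (cases "len x = 2 * m + 1")
      case True
      then have "odd (length as + length bs)" using len by presburger
      then have "x \<in> confs m l \<longleftrightarrow> length as < length bs + 2 * l \<and> length bs < length as + 2 * l"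
        using True by (simp add: confs_def window_def x)
      also have "\<dots> \<longleftrightarrow> m + 1 - l \<le> N + length bs \<and> N + length bs \<le> m + l"
        using True len by linarith
      also have "\<dots> \<longleftrightarrow> word x \<in> (\<Union>k \<in> {m + 1 - l .. m + l}. level (2 * m + 1) k)"
        using True weight by (auto simp: level_def hypercube_vertices_def simp del: word.simps)
      finally show ?thesis .
    next
      case False
      then have "length (word x) \<noteq> 2 * m + 1" by simp
      then show ?thesis using False by (auto simp: confs_def level_def hypercube_vertices_def)
    qed
  qed
  then have "confs m l = word -` (\<Union>k \<in> {m + 1 - l .. m + l}. level (2 * m + 1) k)" by blast
  then show ?thesis using surj_image_vimage_eq[OF surj_word] by simp
qed

lemma pedges_nth: "Suc i < length c \<Longrightarrow> {c ! i, c ! Suc i} \<in> pedges c"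
proof (induction c arbitrary: i rule: pedges.induct)
  case (1 x y xs)
  then show ?case by (cases i) auto
qed auto

theorem theorem1:
  fixes m l :: nat
  assumes "m \<ge> 1" and "1 \<le> l" and "l \<le> m + 1"
  shows "\<exists>cs. hamilton_cycle hypercube_adj
            (\<Union>k \<in> {m + 1 - l .. m + l}. level (2*m+1) k) cs"
proof -
  obtain c where c: "cyc cadj c" "set c = confs m l"
    using ham_exists[OF assms(2)] by (auto simp: ham_def)
  let ?v = "comb m"
  \<comment> \<open>Since \<open>cyc\<close> admits doubled edges, three different vertices are
    exhibited: v 1, v 0 and 1 v, where v is nonempty because of \<open>m \<ge> 1\<close>.\<close>
  let ?W = "{([], ?v, [Eps]), ([?v], Eps, []), ([], Eps, [?v])}"
  have "?v \<noteq> Eps" using assms(1) by (cases m) auto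
  then have "card ?W = 3" by simp
  moreover have "?W \<subseteq> set c" using assms(2) by (auto simp: c confs_def window_def)
  ultimately have "3 \<le> card (set c)" by (metis card_mono finite_set)
  then have "3 \<le> length c" using card_length[of c] by linarith
  have adj: "hypercube_adj (word x) (word y)" if "{x, y} \<in> edges c" for x y
  proof -
    have "cadj x y" using c(1) that unfolding cyc_def by blast
    then show ?thesis unfolding cadj_def by (rule flip_imp_adj)
  qed
  have "hamilton_cycle hypercube_adj (set (map word c)) (map word c)"
    unfolding hamilton_cycle_def
  proof (intro conjI allI impI)
    show "3 \<le> length (map word c)" using \<open>3 \<le> length c\<close> by simp
    show "distinct (map word c)"
      using c(1) inj_on_subset[OF inj_word] unfolding cyc_def distinct_map by blast
    show "hypercube_adj (map word c ! i) (map word c ! Suc i)" if "i < length (map word c) - 1" for i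
      using that adj[of "c ! i" "c ! Suc i"] pedges_nth[of i c] by (simp add: edges_def)
    show "hypercube_adj (last (map word c)) (hd (map word c))"
      using adj[of "last c" "hd c"] cyc_nonempty[OF c(1)] by (simp add: edges_def last_map hd_map)
  qed simp
  then show ?thesis using word_confs[OF assms(3)] c(2) by (metis set_map)
qed

end
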